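(* Let $n \geq 4$, and let $V^{n-1}$ and $\overline{V}^{n-1}$ be two nonisotropic hypersurfaces without umbilical points in a real conformal space $C^n$ or a real pseudoconformal space $C^n_q$ of signature $(p,q)$, $p = n-q$ (both hypersurfaces in the same space); both hypersurfaces are assumed smooth, oriented, connected and simply connected. Suppose that there is a one-to-one correspondence (a smooth bijection with nondegenerate differential) $f: V^{n-1} \rightarrow \overline{V}^{n-1}$ between points of these hypersurfaces such that at corresponding points $$\overline{I} = f_* I ,$$ where $I$ and $\overline{I}$ are the conformal quadratic elements of $V^{n-1}$ and $\overline{V}^{n-1}$ and $f_*: T(V^{n-1}) \to T(\overline{V}^{n-1})$ is the mapping of tangent bundles induced by $f$; that is, for every $x \in V^{n-1}$ one has $\overline{I}_{f(x)}(f_* v) = I_x(v)$ as an identity of rational functions of $v \in T_x(V^{n-1})$. Then the hypersurfaces $V^{n-1}$ and $\overline{V}^{n-1}$ are conformally equivalent, i.e. there exists a conformal transformation $\varphi$ of the space $C^n$ (respectively $C^n_q$) such that $\varphi(V^{n-1}) = \overline{V}^{n-1}$.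
   Context: **Ambient space.** Let $p+q=n$ and let $(\cdot,\cdot)$ be a nondegenerate symmetric bilinear form of signature $(p+1,q+1)$ on $\mathbb{R}^{n+2}$. The pseudoconformal space $C^n_q$ is identified (Darboux mapping) with the projective hyperquadric $Q^n = \{[X] \in P^{n+1} : (X,X)=0\}$; the proper conformal space $C^n$ is the case $q=0$. Conformal transformations are the projective transformations of $P^{n+1}$ that map $Q^n$ onto itself. The form $(\cdot,\cdot)$ matters only up to a nonzero real factor. Hyperspheres correspond to points $[A]\in P^{n+1}$, in general not on $Q^n$; the hypersphere of $A$ passes through $[X]\in Q^n$ iff $(A,X)=0$. **First fundamental form.** Let $V^{n-1} \subset Q^n$ be a smooth hypersurface, and let $A_0$ be a local smooth lift of it, i.e. a local smooth nowhere-zero map $x \mapsto A_0(x) \in \mathbb{R}^{n+2}$ with $[A_0(x)] = x$. The first fundamental form is the quadratic form on the tangent spaces $$g = (dA_0, dA_0).$$ $V^{n-1}$ is called nonisotropic if $g$ is nondegenerate at every point (equivalently, its tangent subspaces are not tangent to the isotropic cones). **Tangent hypersphere.** For nonisotropic $V^{n-1}$, a tangent hypersphere at $x$ is given by a vector $A_n$, not proportional to $A_0$, with $(A_n,A_0)=0$ and $(A_n,dA_0)=0$; then $(A_n,A_n)\neq 0$. The convention is that the sign of the bilinear form is chosen for the given hypersurface (replacing $(\cdot,\cdot)$ by $-(\cdot,\cdot)$ if necessary, in all the formulas including that for $g$) and $A_n$ is scaled so that $(A_n,A_n)=1$. Then $A_n$ is determined at each point up to sign and up to adding a multiple of $A_0$.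 **Second fundamental form and umbilical points.** Put $\widetilde{h} = (d^2A_0, A_n)$. This is a quadratic form on $T_x(V^{n-1})$, equal to $-(dA_0,dA_n)$ for a smooth local choice of $A_n$. Replacing $A_n$ by $A_n + sA_0$ changes $\widetilde h$ to $\widetilde h - s g$. A point $x$ is umbilical if $\widetilde h = \kappa g$ at $x$ for some scalar $\kappa$. The second fundamental form $h$ is the trace-free part of $\widetilde h$ with respect to $g$: writing $g = g_{ij}\omega^i\omega^j$ and $\widetilde h = \lambda_{ij}\omega^i\omega^j$ in a local coframe $\omega^1,\dots,\omega^{n-1}$ of $V^{n-1}$, $$h = h_{ij}\omega^i\omega^j,\qquad h_{ij} = \lambda_{ij} - \lambda g_{ij},\qquad \lambda = \tfrac{1}{n-1}\lambda_{ij}g^{ij},$$ so that $h_{ij}g^{ij}=0$. Thus $x$ is umbilical iff $h=0$ at $x$. The form $h$ is determined up to sign by the lift $A_0$; under $A_0 \mapsto rA_0$ ($r \neq 0$) one has $g\mapsto r^2 g$ and $h \mapsto r h$ (up to sign). **Conformal quadratic element.** This is $$I = \frac{h^2}{g}.$$ At each $x\in V^{n-1}$ it is a well-defined rational function, homogeneous of degree 2, on $T_x(V^{n-1})$ (defined where $g \neq 0$), independent of the choice of lift $A_0$ and of the vector $A_n$. The element $\overline I$ is the same object for $\overline{V}^{n-1}$. *)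

theory Defs
  imports "HOL-Analysis.Analysis"
begin

section \<open>Real projective space\<close>

text \<open>With \<open>CARD('m) = n + 2\<close>, the type \<open>'m projective\<close> is the projective space of dimension
  \<open>n + 1\<close>.\<close>

typedef 'm projective = "{L :: (real^'m::finite) set. subspace L \<and> dim L = 1}"
  morphisms line_of Abs_projective
proof -
  have "span {axis undefined 1 :: real^'m} \<in> {L. subspace L \<and> dim L = 1}"
    by (simp add: dim_insert axis_eq_0_iff)
  then show ?thesis by blast
qed

text \<open>The point \<open>[X]\<close>; meaningful only for \<open>X \<noteq> 0\<close>.\<close>

definition pt :: "real^'m::finite \<Rightarrow> 'm projective" where
  "pt X = Abs_projective (span {X})"

lemma line_of_pt: "X \<noteq> 0 \<Longrightarrow> line_of (pt X) = span {X}"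
  unfolding pt_def by (rule Abs_projective_inverse) (simp add: dim_insert)

lemma pt_eq_iff:
  assumes "X \<noteq> 0" "Y \<noteq> 0"
  shows "pt X = pt Y \<longleftrightarrow> (\<exists>c. c \<noteq> 0 \<and> Y = c *\<^sub>R X)"
proof
  assume "pt X = pt Y"
  then have "span {X} = span {Y}" using assms line_of_pt by metis
  then have "Y \<in> span {X}" by (simp add: span_base)
  then obtain c where "Y = c *\<^sub>R X" by (auto simp: span_singleton)
  with assms show "\<exists>c. c \<noteq> 0 \<and> Y = c *\<^sub>R X" by auto
next
  assume "\<exists>c. c \<noteq> 0 \<and> Y = c *\<^sub>R X"
  then obtain c where c: "c \<noteq> 0" "Y = c *\<^sub>R X" by blast
  have "span {X} = range (\<lambda>k. k *\<^sub>R X)" "span {Y} = range (\<lambda>k. (k * c) *\<^sub>R X)"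
    using c by (auto simp: span_singleton)
  moreover have "k *\<^sub>R X \<in> range (\<lambda>k. (k * c) *\<^sub>R X)" for k
    using c by (intro image_eqI[of _ _ "k / c"]) auto
  ultimately have "span {X} = span {Y}" by auto
  then show "pt X = pt Y" by (simp add: pt_def)
qed

text \<open>The quotient topology of \<open>X \<mapsto> [X]\<close>, \<open>X \<noteq> 0\<close>.\<close>

instantiation projective :: (finite) topological_space
begin

definition open_projective :: "'a projective set \<Rightarrow> bool" where
  "open_projective W \<longleftrightarrow> open {X. X \<noteq> 0 \<and> pt X \<in> W}"

instance
proof
  show "open (UNIV :: 'a projective set)"
  proof -
    have "{X :: real^'a. X \<noteq> 0 \<and> pt X \<in> UNIV} = - {0}" by auto
    then show ?thesis unfolding open_projective_def by (simp add: open_Compl)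
  qed
next
  fix S T :: "'a projective set"
  assume "open S" "open T"
  moreover have "{X. X \<noteq> 0 \<and> pt X \<in> S \<inter> T} = {X. X \<noteq> 0 \<and> pt X \<in> S} \<inter> {X. X \<noteq> 0 \<and> pt X \<in> T}"
    by auto
  ultimately show "open (S \<inter> T)" unfolding open_projective_def by (simp add: open_Int)
next
  fix K :: "'a projective set set"
  assume "\<forall>S\<in>K. open S"
  moreover have "{X. X \<noteq> 0 \<and> pt X \<in> \<Union>K} = (\<Union>S\<in>K. {X. X \<noteq> 0 \<and> pt X \<in> S})" by auto
  ultimately show "open (\<Union>K)" unfolding open_projective_def by auto
qed

end


section \<open>The conformal space and its transformations\<close>

type_synonym 'm form = "real^'m \<Rightarrow> real^'m \<Rightarrow> real"

definition symmetric_form_of_signature :: "'m::finite form \<Rightarrow> nat \<Rightarrow> nat \<Rightarrow> bool" where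
  "symmetric_form_of_signature B r s \<longleftrightarrow>
     bilinear B \<and> (\<forall>X Y. B X Y = B Y X) \<and> r + s = CARD('m) \<and>
     (\<exists>e :: 'm \<Rightarrow> real^'m.
        (\<forall>i j. i \<noteq> j \<longrightarrow> B (e i) (e j) = 0) \<and>
        (\<forall>i. B (e i) (e i) = 1 \<or> B (e i) (e i) = -1) \<and>
        card {i. B (e i) (e i) = 1} = r \<and>
        card {i. B (e i) (e i) = -1} = s)"

definition quadric :: "'m::finite form \<Rightarrow> 'm projective set" where
  "quadric B = {pt X |X. X \<noteq> 0 \<and> B X X = 0}"

definition projective_transformation :: "('m::finite projective \<Rightarrow> 'm projective) \<Rightarrow> bool" where
  "projective_transformation \<phi> \<longleftrightarrow>
     (\<exists>L :: real^'m \<Rightarrow> real^'m. linear L \<and> bij L \<and> (\<forall>X. X \<noteq> 0 \<longrightarrow> \<phi> (pt X) = pt (L X)))"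

definition conformal_transformation ::
    "'m::finite form \<Rightarrow> ('m projective \<Rightarrow> 'm projective) \<Rightarrow> bool" where
  "conformal_transformation B \<phi> \<longleftrightarrow> projective_transformation \<phi> \<and> \<phi> ` quadric B = quadric B"


section \<open>Smooth hypersurfaces\<close>

abbreviation D :: "('a::real_normed_vector \<Rightarrow> 'b::real_normed_vector) \<Rightarrow> 'a \<Rightarrow> 'a \<Rightarrow> 'b" where
  "D F u v \<equiv> frechet_derivative F (at u) v"

text \<open>Differentiability classes on an open set \<open>U\<close>.\<close>

primrec Ck_on ::
    "nat \<Rightarrow> ('a::real_normed_vector \<Rightarrow> 'b::real_normed_vector) \<Rightarrow> 'a set \<Rightarrow> bool" where
  "Ck_on 0 F U \<longleftrightarrow> continuous_on U F"
| "Ck_on (Suc k) F U \<longleftrightarrow> (\<forall>u\<in>U. F differentiable (at u)) \<and> (\<forall>v. Ck_on k (\<lambda>u. D F u v) U)"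

definition smooth_on ::
    "'a::real_normed_vector set \<Rightarrow> ('a \<Rightarrow> 'b::real_normed_vector) \<Rightarrow> bool" where
  "smooth_on U F \<longleftrightarrow> (\<forall>k. Ck_on k F U)"

text \<open>A pair \<open>(U, A)\<close> in \<open>local_lifts V\<close> is a local parametrization \<open>u \<mapsto> [A u]\<close> of \<open>V\<close> by an open
  set \<open>U\<close> of coordinates, together with a smooth lift \<open>A\<close> (the \<open>A\<^sub>0\<close> of the moving frame).
  The condition on the differential says that \<open>u \<mapsto> [A u]\<close> is an immersion into projective space,
  whose tangent space at \<open>[X]\<close> consists of the vectors modulo \<open>X\<close>.\<close>

type_synonym ('k, 'm) lift = "(real^'k) set \<times> (real^'k \<Rightarrow> real^'m)"

definition local_lifts :: "'m::finite projective set \<Rightarrow> ('k::finite, 'm) lift set" where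
  "local_lifts V = {(U, A).
     open U \<and> smooth_on U A \<and> (\<forall>u\<in>U. A u \<noteq> 0) \<and>
     (\<forall>u\<in>U. \<forall>v. D A u v \<in> span {A u} \<longrightarrow> v = 0) \<and>
     openin (top_of_set V) ((\<lambda>u. pt (A u)) ` U) \<and>
     (\<exists>c. homeomorphism U ((\<lambda>u. pt (A u)) ` U) (\<lambda>u. pt (A u)) c)}"

text \<open>The map \<open>f\<close> in the coordinates given by a lift \<open>A\<close> in the source and \<open>(U', A')\<close> in the target.\<close>

definition coord_rep ::
    "('m::finite projective \<Rightarrow> 'm projective) \<Rightarrow> (real^'k \<Rightarrow> real^'m) \<Rightarrow> ('k::finite, 'm) lift
      \<Rightarrow> real^'k \<Rightarrow> real^'k" where
  "coord_rep f A = (\<lambda>(U', A') u. inv_into U' (\<lambda>w. pt (A' w)) (f (pt (A u))))"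

text \<open>A hypersurface is an embedded submanifold of the quadric, of dimension \<open>CARD('k)\<close>.  Its
  orientation is given by an atlas \<open>Or\<close> all of whose coordinate changes have positive Jacobian.\<close>

definition oriented_hypersurface ::
    "'m::finite form \<Rightarrow> 'm projective set \<Rightarrow> ('k::finite, 'm) lift set \<Rightarrow> bool" where
  "oriented_hypersurface B V Or \<longleftrightarrow>
     V \<subseteq> quadric B \<and> Or \<subseteq> local_lifts V \<and>
     (\<forall>x\<in>V. \<exists>(U, A)\<in>Or. x \<in> (\<lambda>u. pt (A u)) ` U) \<and>
     (\<forall>(U, A)\<in>Or. \<forall>(U', A')\<in>Or. \<forall>u\<in>U. pt (A u) \<in> (\<lambda>w. pt (A' w)) ` U' \<longrightarrow>
        (\<exists>J. (coord_rep id A (U', A') has_derivative J) (at u) \<and> det (matrix J) > 0))"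

text \<open>A smooth bijection with nondegenerate differential; the type argument is the index type of
  the coordinates.\<close>

definition smooth_correspondence ::
    "'k::finite itself \<Rightarrow> 'm::finite projective set \<Rightarrow> 'm projective set
      \<Rightarrow> ('m projective \<Rightarrow> 'm projective) \<Rightarrow> bool" where
  "smooth_correspondence _ V V' f \<longleftrightarrow>
     bij_betw f V V' \<and> continuous_on V f \<and>
     (\<forall>(U, A) \<in> (local_lifts V :: ('k, 'm) lift set). \<forall>(U', A') \<in> (local_lifts V' :: ('k, 'm) lift set).
        let W = {u\<in>U. f (pt (A u)) \<in> (\<lambda>w. pt (A' w)) ` U'}; \<tau> = coord_rep f A (U', A')
        in smooth_on W \<tau> \<and> (\<forall>u\<in>W. bij (D \<tau> u)))"


section \<open>Fundamental forms and the conformal quadratic element\<close>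

definition first_form ::
    "'m::finite form \<Rightarrow> (real^'k \<Rightarrow> real^'m) \<Rightarrow> real^'k::finite \<Rightarrow> real^'k \<Rightarrow> real^'k \<Rightarrow> real" where
  "first_form G A u v w = G (D A u v) (D A u w)"

definition nonisotropic ::
    "'k::finite itself \<Rightarrow> 'm::finite form \<Rightarrow> 'm projective set \<Rightarrow> bool" where
  "nonisotropic _ B V \<longleftrightarrow>
     (\<forall>(U, A) \<in> (local_lifts V :: ('k, 'm) lift set). \<forall>u\<in>U. \<forall>v.
        (\<forall>w. first_form B A u v w = 0) \<longrightarrow> v = 0)"

text \<open>A normalized tangent hypersphere \<open>A\<^sub>n\<close>.  It is automatically not proportional to \<open>A u\<close>, which is
  isotropic.\<close>

definition tangent_hypersphere ::
    "'m::finite form \<Rightarrow> (real^'k \<Rightarrow> real^'m) \<Rightarrow> real^'k::finite \<Rightarrow> real^'m \<Rightarrow> bool" where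
  "tangent_hypersphere G A u N \<longleftrightarrow> G N (A u) = 0 \<and> (\<forall>v. G N (D A u v) = 0) \<and> G N N = 1"

text \<open>The sign of the form is chosen so that tangent hyperspheres can be normalized to square \<open>1\<close>.
  The choice is made pointwise; for a nonisotropic hypersurface it is locally constant and independent
  of the lift, hence a single choice for the whole hypersurface if that is connected.\<close>

definition adapted_form ::
    "'m::finite form \<Rightarrow> (real^'k \<Rightarrow> real^'m) \<Rightarrow> real^'k::finite \<Rightarrow> 'm form" where
  "adapted_form B A u = (if \<exists>N. tangent_hypersphere B A u N then B else (\<lambda>X Y. - B X Y))"

definition normal_vector ::
    "'m::finite form \<Rightarrow> (real^'k \<Rightarrow> real^'m) \<Rightarrow> real^'k::finite \<Rightarrow> real^'m" where
  "normal_vector B A u = (SOME N. tangent_hypersphere (adapted_form B A u) A u N)"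

definition g_form ::
    "'m::finite form \<Rightarrow> (real^'k \<Rightarrow> real^'m) \<Rightarrow> real^'k::finite \<Rightarrow> real^'k \<Rightarrow> real^'k \<Rightarrow> real" where
  "g_form B A u = first_form (adapted_form B A u) A u"

text \<open>\<open>(d\<^sup>2A\<^sub>0, A\<^sub>n)\<close>\<close>

definition h_tilde ::
    "'m::finite form \<Rightarrow> (real^'k \<Rightarrow> real^'m) \<Rightarrow> real^'k::finite \<Rightarrow> real^'k \<Rightarrow> real^'k \<Rightarrow> real" where
  "h_tilde B A u v w = adapted_form B A u (D (\<lambda>x. D A x v) u w) (normal_vector B A u)"

definition umbilical_point ::
    "'k::finite itself \<Rightarrow> 'm::finite form \<Rightarrow> 'm projective set \<Rightarrow> 'm projective \<Rightarrow> bool" where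
  "umbilical_point _ B V x \<longleftrightarrow>
     (\<exists>(U, A) \<in> (local_lifts V :: ('k, 'm) lift set). \<exists>u\<in>U. pt (A u) = x \<and>
        (\<exists>\<kappa>. \<forall>v w. h_tilde B A u v w = \<kappa> * g_form B A u v w))"

text \<open>\<open>\<lambda> = (1 / (n - 1)) \<lambda>\<^sub>i\<^sub>j g\<^sup>i\<^sup>j\<close> in the coordinate coframe, where \<open>CARD('k) = n - 1\<close>.\<close>

definition mean_trace ::
    "(real^'k \<Rightarrow> real^'k \<Rightarrow> real) \<Rightarrow> (real^'k::finite \<Rightarrow> real^'k \<Rightarrow> real) \<Rightarrow> real" where
  "mean_trace g l =
     (1 / real CARD('k)) *
     (\<Sum>i\<in>UNIV. \<Sum>j\<in>UNIV. l (axis i 1) (axis j 1) *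
        (matrix_inv (\<chi> a b. g (axis a 1) (axis b 1)) :: real^'k^'k) $ i $ j)"

definition h_form ::
    "'m::finite form \<Rightarrow> (real^'k \<Rightarrow> real^'m) \<Rightarrow> real^'k::finite \<Rightarrow> real^'k \<Rightarrow> real^'k \<Rightarrow> real" where
  "h_form B A u v w =
     h_tilde B A u v w
     - mean_trace (g_form B A u) (h_tilde B A u) * g_form B A u v w"

text \<open>\<open>I = h\<^sup>2 / g\<close>, as a function of the tangent vector with coordinates \<open>v\<close>; meaningful where
  \<open>g_form B A u v v \<noteq> 0\<close>.\<close>

definition conformal_element ::
    "'m::finite form \<Rightarrow> (real^'k \<Rightarrow> real^'m) \<Rightarrow> real^'k::finite \<Rightarrow> real^'k \<Rightarrow> real" where
  "conformal_element B A u v = (h_form B A u v v)\<^sup>2 / g_form B A u v v"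

text \<open>The identity of the two elements at corresponding points, as rational functions on the
  tangent space: equality wherever both denominators are nonzero (a dense set).  The vector \<open>w\<close> is
  the image of \<open>v\<close> under the differential of \<open>f\<close>.\<close>

definition preserves_conformal_element ::
    "'k::finite itself \<Rightarrow> 'm::finite form \<Rightarrow> 'm projective set \<Rightarrow> 'm projective set
      \<Rightarrow> ('m projective \<Rightarrow> 'm projective) \<Rightarrow> bool" where
  "preserves_conformal_element _ B V V' f \<longleftrightarrow>
     (\<forall>(U, A) \<in> (local_lifts V :: ('k, 'm) lift set). \<forall>(U', A') \<in> (local_lifts V' :: ('k, 'm) lift set).
        \<forall>u\<in>U. \<forall>u'\<in>U'. f (pt (A u)) = pt (A' u') \<longrightarrow>
        (\<forall>v. let w = D (coord_rep f A (U', A')) u v in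
           g_form B A u v v \<noteq> 0 \<and> g_form B A' u' w w \<noteq> 0 \<longrightarrow>
           conformal_element B A' u' w = conformal_element B A u v))"

end

(* The element h^2/g determines g and h up to g -> c g, h -> +- sqrt c h, because g has no square
   factor.  After rescaling the lift of V' and moving its normals inside the pencil of tangent
   hyperspheres, the lifts X of V and Y of V' have the same metric and the same second fundamental
   form, so at each point an isometry L (or anti-isometry, if the two hypersurfaces need opposite
   signs of the form) carries X, dX, A_n to Y, dY, A_n', and d^2 X to d^2 Y - s Y.  Antisymmetrizing
   the derivative of (d^2 X, dX) gives the Gauss equation, which says that the Kulkarni-Nomizu
   product of g and s vanishes, so s = 0 since the dimension is at least 3.  The defect
   d^3 Y - L d^3 X has the component a (x) g along the normal, and its total symmetry forces a = 0.
   Hence dL = 0 and L is locally constant.  Where two local L agree with f they are proportional,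
   since 2-jets of a nonumbilical lift span the whole space, so by connectedness one L does for all
   of V. *)

theory Submission
  imports Defs "HOL-Computational_Algebra.Field_as_Ring" "HOL-Computational_Algebra.Polynomial_Factorial"
begin

section \<open>Quadratic forms\<close>

text \<open>The obstacle is that nothing attached to the normals is known to depend smoothly on the
  point: \<open>normal_vector\<close> is a choice made separately at each point, and so is the
  isometry \<open>L\<close>. What can be differentiated are the pairings of the lift and its
  derivatives with each other, so each relation is first brought into the form of an equality of
  such pairings on an open set. In particular the pairing of \<open>D2 X\<close> with itself takes
  over the part that the Codazzi equation for (d^2 X, A_n) would play. For the same reason the frame
  followed along the hypersurface is the 2-jet X, dX, d^2 X and not one containing the normal: its
  members are smooth by construction. It spans because g and h are linearly independent at a
  nonumbilical point; the same independence later solves for the defect of the third derivatives.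
  Differentiability of \<open>L\<close> is a conclusion, drawn from Cramer's rule in that frame. The
  sign of the form is absorbed into a second form \<open>G'\<close>, in the end
  \<open>s * B\<close>, so that isometries and anti-isometries are treated together.\<close>

definition sym_form :: "('a::real_vector \<Rightarrow> 'a \<Rightarrow> real) \<Rightarrow> bool" where
  "sym_form g \<longleftrightarrow> bilinear g \<and> (\<forall>v w. g v w = g w v)"

definition nondegenerate :: "('a::real_vector \<Rightarrow> 'a \<Rightarrow> real) \<Rightarrow> bool" where
  "nondegenerate g \<longleftrightarrow> (\<forall>v. (\<forall>w. g v w = 0) \<longrightarrow> v = 0)"

lemma sym_form_commute: "sym_form g \<Longrightarrow> g v w = g w v"
  by (simp add: sym_form_def)

lemma sym_form_simps:
  assumes "sym_form g"
  shows "g (x + y) z = g x z + g y z" "g z (x + y) = g z x + g z y"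
    "g (x - y) z = g x z - g y z" "g z (x - y) = g z x - g z y"
    "g (c *\<^sub>R x) z = c * g x z" "g z (c *\<^sub>R x) = c * g z x"
    "g (- x) z = - g x z" "g z (- x) = - g z x"
    "g 0 z = 0" "g z 0 = 0"
  using assms unfolding sym_form_def
  by (auto simp: bilinear_ladd bilinear_radd bilinear_lsub bilinear_rsub bilinear_lmul
      bilinear_rmul bilinear_lneg bilinear_rneg bilinear_lzero bilinear_rzero)

lemma sym_formI:
  assumes "\<And>v w. g v w = g w v" "\<And>x y z. g (x + y) z = g x z + g y z"
    "\<And>c x z. g (c *\<^sub>R x) z = c * g x z"
  shows "sym_form g"
proof -
  have "g z (x + y) = g z x + g z y" "g z (c *\<^sub>R x) = c * g z x" for x y z c
    using assms by metis+
  then show ?thesis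
    unfolding sym_form_def bilinear_def using assms by (auto intro!: linearI)
qed

lemma sym_form_scale: "sym_form g \<Longrightarrow> sym_form (\<lambda>v w. c * g v w)"
  by (rule sym_formI) (auto simp: sym_form_simps algebra_simps sym_form_commute)

lemma sym_form_diff: "sym_form g \<Longrightarrow> sym_form h \<Longrightarrow> sym_form (\<lambda>v w. g v w - h v w)"
  by (rule sym_formI) (auto simp: sym_form_simps algebra_simps sym_form_commute)

lemma sym_form_pullback: "sym_form g \<Longrightarrow> linear T \<Longrightarrow> sym_form (\<lambda>v w. g (T v) (T w))"
  by (rule sym_formI) (auto simp: sym_form_simps linear_add linear_scale sym_form_commute)

lemma sym_form_bounded_bilinear:
  fixes g :: "'a::euclidean_space \<Rightarrow> 'a \<Rightarrow> real"
  shows "sym_form g \<Longrightarrow> bounded_bilinear g"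
  by (simp add: sym_form_def bilinear_conv_bounded_bilinear)

text \<open>On an affine line a quadratic form is a polynomial in the parameter, which makes root
  counting and divisibility available.\<close>

lemma sym_form_line:
  assumes "sym_form g"
  shows "g (v + t *\<^sub>R a) (v + t *\<^sub>R a) = poly [:g v v, 2 * g v a, g a a:] t"
  using sym_form_commute[OF assms, of a v]
  by (simp add: sym_form_simps[OF assms] algebra_simps)

lemma sym_form_polarization:
  assumes "sym_form g" "\<And>v. g v v = 0" shows "g v w = 0"
  using assms(2)[of "v + w"] assms(2)[of v] assms(2)[of w] sym_form_commute[OF assms(1), of v w]
  by (simp add: sym_form_simps[OF assms(1)])

lemma sym_form_eqI:
  assumes "sym_form g" "sym_form h" "\<And>v. g v v = h v v" shows "g v w = h v w"
  using sym_form_polarization[OF sym_form_diff[OF assms(1,2)]] assms(3) by simp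

lemma nondegenerate_nonnull:
  fixes g :: "'a::euclidean_space \<Rightarrow> 'a \<Rightarrow> real"
  assumes "sym_form g" "nondegenerate g" obtains a where "g a a \<noteq> 0"
proof (rule ccontr)
  assume "\<not> thesis"
  then have "g a a = 0" for a using that by blast
  then have "g v w = 0" for v w using sym_form_polarization[OF assms(1)] by blast
  then have "v = 0" for v :: 'a using assms(2) unfolding nondegenerate_def by blast
  moreover obtain b :: 'a where "b \<in> Basis" using nonempty_Basis by blast
  ultimately show False using nonzero_Basis by blast
qed

text \<open>The complement of the null cone is dense: along a nonnull direction \<open>a\<close> the
  form is a nonzero polynomial in the parameter, so nonnull points accumulate at \<open>v\<close>.
  This is how denominators are cleared and factors cancelled below.\<close>

lemma eq_off_null_cone:
  fixes g :: "'a::euclidean_space \<Rightarrow> 'a \<Rightarrow> real" and F H :: "'a \<Rightarrow> real"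
  assumes g: "sym_form g" and a: "g a a \<noteq> 0"
    and F: "continuous_on UNIV F" and H: "continuous_on UNIV H"
    and eq: "\<And>v. g v v \<noteq> 0 \<Longrightarrow> F v = H v"
  shows "F v = H v"
proof -
  let ?p = "[:g v v, 2 * g v a, g a a:]"
  have "?p \<noteq> 0" using a by simp
  then have "finite {t. poly ?p t = 0}" by (rule poly_roots_finite)
  \<comment> \<open>If \<open>v\<close> is null then 0 is itself a root; it is taken out because
    only a punctured neighbourhood of 0 matters.\<close>
  then have "closed ({t. poly ?p t = 0} - {0})" by (simp add: finite_imp_closed)
  then have "eventually (\<lambda>t. t \<in> - ({t. poly ?p t = 0} - {0})) (nhds 0)"
    by (intro eventually_nhds_in_open) (simp_all only: open_Compl, simp)
  then have "eventually (\<lambda>t. poly ?p t \<noteq> 0) (at 0)"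
    unfolding eventually_at_filter by eventually_elim auto
  then have ev: "eventually (\<lambda>t. F (v + t *\<^sub>R a) = H (v + t *\<^sub>R a)) (at 0)"
    by eventually_elim (simp add: eq sym_form_line[OF g])
  have *: "((\<lambda>t. K (v + t *\<^sub>R a)) \<longlongrightarrow> K v) (at 0)" if "continuous_on UNIV K" for K :: "'a \<Rightarrow> real"
  proof -
    have "isCont K (v + 0 *\<^sub>R a)" using that by (simp add: continuous_on_eq_continuous_at)
    moreover have "isCont (\<lambda>t::real. v + t *\<^sub>R a) 0" by (intro continuous_intros)
    ultimately have "isCont (\<lambda>t::real. K (v + t *\<^sub>R a)) 0"
      by (rule isCont_o2[where f = "\<lambda>t::real. v + t *\<^sub>R a" and g = K, rotated])
    then show ?thesis by (simp add: isCont_def)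
  qed
  have "((\<lambda>t. F (v + t *\<^sub>R a)) \<longlongrightarrow> H v) (at 0)"
    using *[OF H] by (rule Lim_transform_eventually) (use ev in \<open>eventually_elim; simp\<close>)
  then show ?thesis using *[OF F] by (rule tendsto_unique[OF at_neq_bot, symmetric])
qed

section \<open>Recovering two quadratic forms from the quotient of a square by a form\<close>

lemma continuous_on_quadratic:
  fixes g :: "'a::euclidean_space \<Rightarrow> 'a \<Rightarrow> real"
  assumes "sym_form g" shows "continuous_on UNIV (\<lambda>v. g v v)"
  by (intro bounded_bilinear.continuous_on[OF sym_form_bounded_bilinear[OF assms]] continuous_intros)

text \<open>Write k / h in lowest terms. The square of the reduced denominator divides
  \<open>Q\<close>, whose discriminant is nonzero, so that denominator is constant; then
  \<open>P\<close> is a multiple of the squared numerator times \<open>Q\<close>, and the bound on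
  its degree makes the numerator constant too.\<close>

lemma quadratic_square_quotient:
  fixes Q P h k :: "real poly"
  assumes eq: "k\<^sup>2 * Q = h\<^sup>2 * P" and Q: "Q = [:q0, q1, q2:]" and q2: "q2 \<noteq> 0"
    and disc: "q1\<^sup>2 \<noteq> 4 * q0 * q2" and P: "degree P \<le> 2" and h: "h \<noteq> 0"
  shows "\<exists>c. P = smult c Q"
proof (cases "k = 0")
  case True
  then show ?thesis using eq h by (intro exI[of _ 0]) auto
next
  case False
  have dQ: "degree Q = 2" using Q q2 by simp
  then have Q0: "Q \<noteq> 0" by auto
  define d where "d = gcd k h"
  have d0: "d \<noteq> 0" using h by (simp add: d_def)
  then obtain k1 h1 where kh: "k = k1 * d" "h = h1 * d" and cop: "coprime k1 h1"
    unfolding d_def using gcd_coprime_exists by blast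
  have "d\<^sup>2 * (k1\<^sup>2 * Q) = d\<^sup>2 * (h1\<^sup>2 * P)"
    using eq unfolding kh by (simp add: power_mult_distrib mult_ac)
  then have e1: "k1\<^sup>2 * Q = h1\<^sup>2 * P" using d0 by simp
  have "h1\<^sup>2 dvd Q"
  proof -
    have "h1\<^sup>2 dvd k1\<^sup>2 * Q" by (simp add: e1)
    moreover have "coprime (h1\<^sup>2) (k1\<^sup>2)" using cop by (simp add: coprime_commute)
    ultimately show ?thesis by (simp add: coprime_dvd_mult_right_iff)
  qed
  then obtain r where r: "Q = h1\<^sup>2 * r" by (elim dvdE)
  have nz: "h1 \<noteq> 0" "r \<noteq> 0" using Q0 r by auto
  have deg: "2 * degree h1 + degree r = 2"
    using dQ nz unfolding r by (simp add: degree_mult_eq degree_power_eq)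
  have "degree h1 = 0"
  proof (rule ccontr)
    assume "degree h1 \<noteq> 0"
    then have "degree h1 = 1" "degree r = 0" using deg by auto
    then obtain x y c where xy: "h1 = [:x, y:]" "r = [:c:]"
      by (metis degree_eq_zeroE degree1_coeffs One_nat_def)
    then have "q0 = c * x\<^sup>2" "q1 = c * (2 * x * y)" "q2 = c * y\<^sup>2"
      using r Q by (auto simp: power2_eq_square algebra_simps)
    then show False using disc by (simp add: power2_eq_square algebra_simps)
  qed
  then obtain x where x: "h1 = [:x:]" by (rule degree_eq_zeroE)
  then have x0: "x \<noteq> 0" using nz by simp
  have e2: "k1\<^sup>2 * Q = smult (x\<^sup>2) P" using e1 x by (simp add: power2_eq_square)
  have k10: "k1 \<noteq> 0" using False kh by auto
  have "2 * degree k1 + 2 = degree (k1\<^sup>2 * Q)"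
    using k10 Q0 dQ by (simp add: degree_mult_eq degree_power_eq)
  also have "\<dots> \<le> 2" using P x0 unfolding e2 by simp
  finally have "degree k1 = 0" by simp
  then obtain y where y: "k1 = [:y:]" by (rule degree_eq_zeroE)
  have "smult (x\<^sup>2) P = smult (y\<^sup>2) Q" using e2 y by (simp add: power2_eq_square)
  then have "smult (1 / x\<^sup>2) (smult (x\<^sup>2) P) = smult (1 / x\<^sup>2) (smult (y\<^sup>2) Q)" by simp
  then have "P = smult (y\<^sup>2 / x\<^sup>2) Q" using x0 by simp
  then show ?thesis ..
qed

text \<open>Nondegeneracy makes \<open>g\<close> squarefree on the line through \<open>a\<close> and a generic \<open>b\<close>, so there
  \<open>g\<close> divides \<open>g'\<close>.\<close>

lemma quadratic_element_determines_forms: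
  fixes g g' h h' :: "'a::euclidean_space \<Rightarrow> 'a \<Rightarrow> real"
  assumes forms: "sym_form g" "sym_form g'" "sym_form h" "sym_form h'"
    and nd: "nondegenerate g" "nondegenerate g'" and dim: "DIM('a) \<ge> 2"
    and h: "h v0 w0 \<noteq> 0"
    and eq: "\<And>v. g v v \<noteq> 0 \<Longrightarrow> g' v v \<noteq> 0 \<Longrightarrow> (h' v v)\<^sup>2 / g' v v = (h v v)\<^sup>2 / g v v"
  obtains c \<sigma> where "c > 0" "\<And>v w. g' v w = c * g v w" "\<sigma> = 1 \<or> \<sigma> = - 1"
    "\<And>v w. h' v w = \<sigma> * sqrt c * h v w"
proof -
  note [continuous_intros] = continuous_on_quadratic[OF forms(1)] continuous_on_quadratic[OF forms(2)]
    continuous_on_quadratic[OF forms(3)] continuous_on_quadratic[OF forms(4)]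
  note simps = sym_form_simps[OF forms(1)] 
  obtain a1 where a1: "g a1 a1 \<noteq> 0" using forms(1) nd(1) by (rule nondegenerate_nonnull)
  obtain a2 where a2: "g' a2 a2 \<noteq> 0" using forms(2) nd(2) by (rule nondegenerate_nonnull)
  obtain a3 where a3: "h a3 a3 \<noteq> 0" using h sym_form_polarization[OF forms(3)] by blast
  \<comment> \<open>The surplus factor \<open>g v v\<close> makes both sides vanish on the null cone
    of \<open>g\<close>, so the two cones can be removed one after the other: that of
    \<open>g'\<close> here, that of \<open>g\<close> in \<open>e1\<close>.\<close>
  have e0: "g v v * ((h' v v)\<^sup>2 * g v v) = g v v * ((h v v)\<^sup>2 * g' v v)" for v
    by (rule eq_off_null_cone[OF forms(2) a2])
      (use eq in \<open>force intro!: continuous_intros simp: divide_simps\<close>)+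
  have e1: "(h' v v)\<^sup>2 * g v v = (h v v)\<^sup>2 * g' v v" for v
    by (rule eq_off_null_cone[OF forms(1) a1]) (use e0 in \<open>auto intro!: continuous_intros\<close>)
  have "\<exists>a. g a a \<noteq> 0 \<and> h a a \<noteq> 0"
  proof (rule ccontr)
    assume "\<nexists>a. g a a \<noteq> 0 \<and> h a a \<noteq> 0"
    note none = this
    have "h a3 a3 = 0"
      by (rule eq_off_null_cone[OF forms(1) a1, where F = "\<lambda>v. h v v" and H = "\<lambda>_. 0"])
        (use none in \<open>auto intro!: continuous_intros\<close>)
    then show False using a3 by simp
  qed
  then obtain a where ga: "g a a \<noteq> 0" and ha: "h a a \<noteq> 0" by blast
  \<comment> \<open>Up to a factor 4, \<open>disc v v\<close> is the discriminant of
    \<open>g\<close> on the line through \<open>v\<close> in direction \<open>a\<close>. It is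
    itself quadratic in \<open>v\<close>, so a single nonzero value makes it nonzero on a dense
    set.\<close>
  define disc where "disc v w = g a v * g a w - g a a * g v w" for v w
  have disc: "sym_form disc"
    by (rule sym_formI)
      (auto simp: disc_def sym_form_simps[OF forms(1)] algebra_simps sym_form_commute[OF forms(1)])
  obtain b0 where b0: "disc b0 b0 \<noteq> 0"
  proof (rule ccontr)
    assume "\<not> thesis"
    then have "disc v w = 0" for v w using sym_form_polarization[OF disc] that by blast
    then have *: "g a v * g a w = g a a * g v w" for v w by (simp add: disc_def)
    have "dim {a} < DIM('a)" using dim dim_le_card'[of "{a}"] by simp
    then have "span {a} \<noteq> UNIV" by (metis dim_span dim_UNIV less_irrefl)
    then obtain z where z: "z \<notin> span {a}" by blast
    \<comment> \<open>The part of \<open>z\<close> orthogonal to \<open>a\<close> would lie in the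
      kernel of \<open>g\<close>.\<close>
    define b where "b = z - (g a z / g a a) *\<^sub>R a"
    have "b \<noteq> 0" using z by (auto simp: b_def span_singleton)
    moreover have "g a b = 0" using ga by (simp add: b_def simps)
    then have "g b w = 0" for w using *[of b w] ga by simp
    ultimately show False using nd(1) unfolding nondegenerate_def by blast
  qed
  \<comment> \<open>All lines considered have direction \<open>a\<close>, hence the same leading
    coefficients \<open>g a a\<close> and \<open>g' a a\<close>; so the factor does not depend on
    the line.\<close>
  define c where "c = g' a a / g a a"
  have "g' b b = c * g b b" if "disc b b \<noteq> 0" for b
  proof -
    let ?line = "\<lambda>f :: 'a \<Rightarrow> 'a \<Rightarrow> real. [:f b b, 2 * f b a, f a a:]"
    have "poly ((?line h')\<^sup>2 * ?line g) t = poly ((?line h)\<^sup>2 * ?line g') t" for t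
      using e1[of "b + t *\<^sub>R a"] by (simp only: poly_mult poly_power sym_form_line[OF forms(1)]
          sym_form_line[OF forms(2)] sym_form_line[OF forms(3)] sym_form_line[OF forms(4)])
    then have "(?line h')\<^sup>2 * ?line g = (?line h)\<^sup>2 * ?line g'" 
      using poly_eq_poly_eq_iff by blast
    moreover have "(2 * g b a)\<^sup>2 \<noteq> 4 * g b b * g a a"
      using that sym_form_commute[OF forms(1), of a b]
      by (simp add: disc_def power2_eq_square algebra_simps)
    moreover have "degree (?line g') \<le> 2" by (simp add: degree_pCons_le)
    moreover have "?line h \<noteq> 0" using ha by simp
    ultimately have "\<exists>d. ?line g' = smult d (?line g)"
      by (intro quadratic_square_quotient[OF _ refl ga])
    then obtain d where "?line g' = smult d (?line g)" ..
    then have "g' b b = d * g b b" "g' a a = d * g a a" by auto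
    then show ?thesis using ga by (simp add: c_def)
  qed
  note generic = this
  have qc: "g' v v = c * g v v" for v
    by (rule eq_off_null_cone[OF disc b0]) (use generic in \<open>auto intro!: continuous_intros\<close>)
  have g'c: "g' v w = c * g v w" for v w
    using sym_form_eqI[OF forms(2) sym_form_scale[OF forms(1)]] qc by blast
  have sq: "(h' v v)\<^sup>2 = c * (h v v)\<^sup>2" for v
    by (rule eq_off_null_cone[OF forms(1) a1])
      (use e1 qc in \<open>auto intro!: continuous_intros simp: mult_ac\<close>)
  have "c * (h a a)\<^sup>2 \<ge> 0" by (metis sq zero_le_power2)
  then have "c \<ge> 0" using ha by (simp add: zero_le_mult_iff)
  moreover have "c \<noteq> 0" using a2 qc by auto
  ultimately have c: "c > 0" by simp
  \<comment> \<open>A priori the sign relating \<open>h'\<close> to \<open>sqrt c * h\<close> could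
    vary with \<open>v\<close>. But the quadratic forms \<open>k 1\<close> and \<open>k (-1)\<close>
    have product zero, and off the null cone of one the other vanishes, hence everywhere by
    density.\<close>
  define k where "k \<sigma> v w = h' v w - \<sigma> * sqrt c * h v w" for \<sigma> v w
  have k: "sym_form (k \<sigma>)" for \<sigma>
    unfolding k_def by (intro sym_form_diff sym_form_scale forms)
  have kk: "k 1 v v * k (-1) v v = 0" for v
    using sq[of v] c by (simp add: k_def algebra_simps power2_eq_square flip: real_sqrt_mult)
  have "(\<forall>v. k 1 v v = 0) \<or> (\<forall>v. k (-1) v v = 0)"
  proof (rule disjCI)
    assume "\<not> (\<forall>v. k (-1) v v = 0)"
    then obtain b where b: "k (-1) b b \<noteq> 0" by blast
    show "\<forall>v. k 1 v v = 0"
      by (intro allI, rule eq_off_null_cone[OF k b, where H = "\<lambda>_. 0"])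
        (use kk continuous_on_quadratic[OF k] in \<open>auto intro!: continuous_intros\<close>)
  qed
  then obtain \<sigma> :: real where s: "\<sigma> = 1 \<or> \<sigma> = - 1" "\<And>v. k \<sigma> v v = 0" by metis
  have "h' v w = \<sigma> * sqrt c * h v w" for v w
    using sym_form_polarization[OF k s(2), of v w] by (simp add: k_def)
  then show ?thesis using that c g'c s(1) by blast
qed

section \<open>Two algebraic cancellation lemmas\<close>

lemma nondegenerate_third_orthogonal:
  fixes g :: "'a::euclidean_space \<Rightarrow> 'a \<Rightarrow> real"
  assumes g: "sym_form g" "nondegenerate g" and dim: "DIM('a) \<ge> 3"
    and x: "g x x \<noteq> 0" and y: "g y y \<noteq> 0 \<or> y = 0" and xy: "g x y = 0"
  obtains z where "g z x = 0" "g z y = 0" "g z z \<noteq> 0"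
proof -
  note simps = sym_form_simps[OF g(1)]
  let ?T = "\<lambda>z. (g z x, g z y)"
  have lin: "linear ?T" by (rule linearI) (auto simp: simps)
  have "\<not> inj ?T"
  proof
    assume "inj ?T"
    then have "dim (range ?T) = DIM('a)" using lin by (simp add: dim_image_eq)
    moreover have "dim (range ?T) \<le> 2" using dim_subset_UNIV[of "range ?T"] by simp
    ultimately show False using dim by simp
  qed
  then have "\<exists>n. ?T n = 0 \<and> n \<noteq> 0" using linear_injective_0[OF lin] by blast
  then obtain n where n: "n \<noteq> 0" "g n x = 0" "g n y = 0" by (auto simp: zero_prod_def)
  have "\<exists>z. g z x = 0 \<and> g z y = 0 \<and> g z z \<noteq> 0"
  proof (rule ccontr)
    assume "\<nexists>z. g z x = 0 \<and> g z y = 0 \<and> g z z \<noteq> 0"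
    then have null: "g z z = 0" if "g z x = 0" "g z y = 0" for z using that by blast
    \<comment> \<open>If the whole complement of \<open>x\<close> and \<open>y\<close> were null,
      polarization would make \<open>n\<close> orthogonal to it, and the projection below would make
      \<open>n\<close> orthogonal to every vector.\<close>
    have perp: "g n z = 0" if "g z x = 0" "g z y = 0" for z
      using null[of "n + z"] null[of n] null[of z] n that sym_form_commute[OF g(1), of z n]
      by (simp add: simps)
    have "g n v = 0" for v
    proof -
      \<comment> \<open>For \<open>y = 0\<close> the last term is zero whatever its
        coefficient.\<close>
      let ?z = "v - (g v x / g x x) *\<^sub>R x - (g v y / g y y) *\<^sub>R y"
      have "g ?z x = 0" "g ?z y = 0"
        using x y xy sym_form_commute[OF g(1), of y x] by (auto simp: simps)
      then have "g n ?z = 0" by (rule perp)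
      then show ?thesis using n by (simp add: simps)
    qed
    then show False using n g(2) unfolding nondegenerate_def by blast
  qed
  then show ?thesis using that by blast
qed

text \<open>On two orthogonal nonnull vectors the identity says that the ratios s / g are opposite.
  Three mutually orthogonal ones give three numbers with all pairwise sums zero. In dimension two a
  trace-free \<open>s\<close> would satisfy the identity.\<close>

lemma kulkarni_nomizu_injective:
  fixes g s :: "'a::euclidean_space \<Rightarrow> 'a \<Rightarrow> real"
  assumes g: "sym_form g" "nondegenerate g" and dim: "DIM('a) \<ge> 3" and s: "sym_form s"
    and eq: "\<And>v z w t. s v z * g w t + s w t * g v z = s v t * g w z + s w z * g v t"
  shows "s v w = 0"
proof -
  obtain a where a: "g a a \<noteq> 0" using g by (rule nondegenerate_nonnull)
  have pair: "s x x / g x x + s y y / g y y = 0"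
    if "g x x \<noteq> 0" "g y y \<noteq> 0" "g x y = 0" for x y
    using eq[of x x y y] that sym_form_commute[OF g(1), of y x] by (simp add: field_simps)
  have s0: "s x x = 0" if x: "g x x \<noteq> 0" for x
  proof -
    obtain y where y: "g y x = 0" "g y y \<noteq> 0"
      using nondegenerate_third_orthogonal[OF g dim x, of 0] sym_form_simps(9,10)[OF g(1)] by metis
    obtain z where z: "g z x = 0" "g z y = 0" "g z z \<noteq> 0"
      using nondegenerate_third_orthogonal[OF g dim x, of y] y sym_form_commute[OF g(1), of x y]
      by metis
    from pair[OF y(2) x y(1)] pair[OF z(3) x z(1)] pair[OF z(3) y(2) z(2)]
    have "s x x / g x x = 0" by linarith
    then show ?thesis using x by simp
  qed
  have "s x x = 0" for x
    by (rule eq_off_null_cone[OF g(1) a, where F = "\<lambda>x. s x x" and H = "\<lambda>_. 0"])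
      (use s0 continuous_on_quadratic[OF s] in auto)
  then show ?thesis using sym_form_polarization[OF s] by blast
qed

text \<open>The hypothesis is \<nu> h = \<delta> g in the symmetric algebra, with g and h
  independent of degree one, so unique factorization predicts the common scalar factor
  \<open>a\<close>. The proof is elementary: evaluate at a point where g does not vanish and at one
  that separates h from g.\<close>

lemma symmetrized_product_eq:
  fixes g h \<nu> \<delta> :: "'p \<Rightarrow> real"
  assumes eq: "\<And>p q. \<nu> p * h q + \<nu> q * h p = \<delta> p * g q + \<delta> q * g p"
    and p0: "g p0 \<noteq> 0" and indep: "\<nexists>\<kappa>. \<forall>p. h p = \<kappa> * g p"
  obtains a where "\<And>p. \<nu> p = a * g p" "\<And>p. \<delta> p = a * h p"
proof -
  define \<kappa> where "\<kappa> = h p0 / g p0"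
  \<comment> \<open>Subtracting \<kappa> g from h and \<kappa> \<nu> from \<delta> keeps the shape
    of the identity and makes the new h vanish at \<open>p0\<close>.\<close>
  define h1 where "h1 p = h p - \<kappa> * g p" for p
  define d1 where "d1 p = \<delta> p - \<kappa> * \<nu> p" for p
  define a where "a = \<nu> p0 / g p0"
  have e: "\<nu> p * h1 q + \<nu> q * h1 p = d1 p * g q + d1 q * g p" for p q
    using eq[of p q] by (simp add: h1_def d1_def algebra_simps)
  have h10: "h1 p0 = 0" using p0 by (simp add: h1_def \<kappa>_def)
  have d0: "d1 p0 = 0" using e[of p0 p0] h10 p0 by simp
  have d1: "d1 p = a * h1 p" for p
    using e[of p p0] h10 d0 p0 by (simp add: a_def field_simps)
  obtain p1 where p1: "h1 p1 \<noteq> 0" using indep by (auto simp: h1_def)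
  have f: "(\<nu> p - a * g p) * h1 q + (\<nu> q - a * g q) * h1 p = 0" for p q
    using e[of p q] by (simp add: d1 algebra_simps)
  have n1: "\<nu> p1 = a * g p1" using f[of p1 p1] p1 by simp
  have n: "\<nu> p = a * g p" for p using f[of p p1] n1 p1 by simp
  moreover have "\<delta> p = a * h p" for p
    using d1[of p] n[of p] by (simp add: d1_def h1_def algebra_simps)
  ultimately show ?thesis by (rule that)
qed

section \<open>Calculus\<close>

lemma D_eqI: "(F has_derivative F') (at u) \<Longrightarrow> D F u = F'"
  by (rule frechet_derivative_at[symmetric])

lemma has_derivative_D: "F differentiable (at u) \<Longrightarrow> (F has_derivative D F u) (at u)"
  by (simp add: frechet_derivative_works)

lemma linear_D: "F differentiable (at u) \<Longrightarrow> linear (D F u)"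
  by (rule linear_frechet_derivative)

lemma D_cong:
  assumes "open U" "u \<in> U" "\<And>x. x \<in> U \<Longrightarrow> F x = G x" "F differentiable (at u)"
  shows "G differentiable (at u)" "D G u = D F u"
proof -
  have "(G has_derivative D F u) (at u)"
    using has_derivative_transform_within_open[OF has_derivative_D[OF assms(4)] assms(1,2,3)] .
  then show "G differentiable (at u)" "D G u = D F u"
    by (auto simp: differentiable_def D_eqI)
qed

section \<open>Closure properties of the differentiability classes\<close>

lemma Ck_on_subset: "Ck_on k F U \<Longrightarrow> W \<subseteq> U \<Longrightarrow> Ck_on k F W"
  by (induction k arbitrary: F) (auto intro: continuous_on_subset)

lemma smooth_on_subset: "smooth_on U F \<Longrightarrow> W \<subseteq> U \<Longrightarrow> smooth_on W F"
  unfolding smooth_on_def by (blast intro: Ck_on_subset)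

lemma Ck_on_SucD: "Ck_on (Suc k) F U \<Longrightarrow> Ck_on k F U"
proof (induction k arbitrary: F)
  case 0
  then show ?case
    by (auto simp: differentiable_imp_continuous_within intro!: continuous_at_imp_continuous_on)
next
  case (Suc k)
  then show ?case by (metis Ck_on.simps(2))
qed

lemma Ck_on_mono: "Ck_on k F U \<Longrightarrow> j \<le> k \<Longrightarrow> Ck_on j F U"
proof (induction k)
  case (Suc k)
  then show ?case by (metis Ck_on_SucD le_Suc_eq)
qed simp

lemma Ck_on_continuous: "Ck_on k F U \<Longrightarrow> continuous_on U F"
  using Ck_on_mono[of k F U 0] by simp

lemma Ck_on_cong: "open U \<Longrightarrow> (\<And>u. u \<in> U \<Longrightarrow> F u = G u) \<Longrightarrow> Ck_on k F U \<Longrightarrow> Ck_on k G U"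
proof (induction k arbitrary: F G)
  case 0
  then show ?case using continuous_on_cong by force
next
  case (Suc k)
  note D = D_cong[OF Suc(2) _ Suc(3)]
  have "Ck_on k (\<lambda>u. D G u v) U" for v
  proof (rule Suc.IH[OF Suc(2)])
    show "D F u v = D G u v" if "u \<in> U" for u using D(2)[OF that] Suc(4) that by simp
    show "Ck_on k (\<lambda>u. D F u v) U" using Suc(4) by simp
  qed
  then show ?case using D(1) Suc(4) by simp
qed

lemma Ck_on_const: "Ck_on k (\<lambda>_. c) U"
  by (induction k arbitrary: c) (auto simp: D_eqI[OF has_derivative_const])

lemma Ck_on_add: "open U \<Longrightarrow> Ck_on k F U \<Longrightarrow> Ck_on k G U \<Longrightarrow> Ck_on k (\<lambda>u. F u + G u) U"
proof (induction k arbitrary: F G)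
  case (Suc k)
  have D: "((\<lambda>u. F u + G u) has_derivative (\<lambda>v. D F u v + D G u v)) (at u)" if "u \<in> U" for u
    using Suc(3,4) that by (auto intro!: derivative_eq_intros has_derivative_D)
  have "Ck_on k (\<lambda>u. D (\<lambda>u. F u + G u) u v) U" for v
    by (rule Ck_on_cong[OF Suc(2), of "\<lambda>u. D F u v + D G u v"])
      (use Suc D_eqI[OF D] in auto)
  then show ?case using D by (auto simp: differentiable_def)
qed (auto intro: continuous_on_add)

lemma Ck_on_sum:
  "open U \<Longrightarrow> (\<And>i. i \<in> I \<Longrightarrow> Ck_on k (F i) U) \<Longrightarrow> Ck_on k (\<lambda>u. \<Sum>i\<in>I. F i u) U"
  by (induction I rule: infinite_finite_induct) (auto intro: Ck_on_add Ck_on_const)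

lemma Ck_on_bilinear:
  assumes "bounded_bilinear op2"
  shows "open U \<Longrightarrow> Ck_on k F U \<Longrightarrow> Ck_on k G U \<Longrightarrow> Ck_on k (\<lambda>u. op2 (F u) (G u)) U"
proof (induction k arbitrary: F G)
  case 0
  then show ?case using bounded_bilinear.continuous_on[OF assms] by simp
next
  case (Suc k)
  have D: "((\<lambda>u. op2 (F u) (G u)) has_derivative (\<lambda>v. op2 (F u) (D G u v) + op2 (D F u v) (G u))) (at u)"
    if "u \<in> U" for u
    using Suc(3,4) that by (intro bounded_bilinear.FDERIV[OF assms] has_derivative_D) auto
  have "Ck_on k (\<lambda>u. op2 (F u) (D G u v) + op2 (D F u v) (G u)) U" for v
    using Suc by (intro Ck_on_add Suc.IH) (auto intro: Ck_on_SucD)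
  then have "Ck_on k (\<lambda>u. D (\<lambda>u. op2 (F u) (G u)) u v) U" for v
    by (rule Ck_on_cong[OF Suc(2), rotated]) (use D_eqI[OF D] in auto)
  then show ?case using D by (auto simp: differentiable_def)
qed

lemma Ck_on_compose:
  fixes F :: "'a::euclidean_space \<Rightarrow> 'b::real_normed_vector"
  assumes "open W" "\<tau> ` W \<subseteq> U"
  shows "Ck_on k F U \<Longrightarrow> Ck_on k \<tau> W \<Longrightarrow> Ck_on k (\<lambda>u. F (\<tau> u)) W"
proof (induction k arbitrary: F)
  case 0
  then have "continuous_on U F" "continuous_on W \<tau>" by simp_all
  from continuous_on_compose2[OF this assms(2)] show ?case by simp
next
  case (Suc k)
  have D: "((\<lambda>u. F (\<tau> u)) has_derivative (\<lambda>v. D F (\<tau> u) (D \<tau> u v))) (at u)" if "u \<in> W" for u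
    using Suc(2,3) that assms
    by (intro has_derivative_compose[OF has_derivative_D has_derivative_D]) auto
  \<comment> \<open>\<open>Ck_on\<close> speaks of derivatives in fixed directions, while the chain
    rule produces the moving direction \<open>D \<tau> u v\<close>; expanding it in the basis
    restores fixed ones.\<close>
  have expand: "D F (\<tau> u) (D \<tau> u v) = (\<Sum>b\<in>Basis. inner (D \<tau> u v) b *\<^sub>R D F (\<tau> u) b)" if "u \<in> W" for u v
  proof -
    have lin: "linear (D F (\<tau> u))" using Suc(2) that assms by (intro linear_D) auto
    have "D F (\<tau> u) (\<Sum>b\<in>Basis. inner (D \<tau> u v) b *\<^sub>R b)
      = (\<Sum>b\<in>Basis. inner (D \<tau> u v) b *\<^sub>R D F (\<tau> u) b)"
      by (simp add: linear_sum[OF lin] linear_scale[OF lin])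
    then show ?thesis by (simp add: euclidean_representation)
  qed
  have "Ck_on k (\<lambda>u. \<Sum>b\<in>Basis. inner (D \<tau> u v) b *\<^sub>R D F (\<tau> u) b) W" for v
    using Suc assms(1) Ck_on_SucD[OF Suc(3)]
    by (intro Ck_on_sum Ck_on_bilinear[OF bounded_bilinear_scaleR] Suc.IH
        Ck_on_bilinear[OF bounded_bilinear_inner] Ck_on_const) auto
  then have "Ck_on k (\<lambda>u. D (\<lambda>u. F (\<tau> u)) u v) W" for v
    by (rule Ck_on_cong[OF assms(1), rotated]) (use expand D_eqI[OF D] in auto)
  then show ?case using D by (auto simp: differentiable_def)
qed

text \<open>The derivative is a product of copies of the function itself and \<open>D r\<close>, so
  the induction closes with the product rule alone.\<close>

lemma Ck_on_inverse_sqrt: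
  fixes r :: "'a::real_normed_vector \<Rightarrow> real"
  assumes "open U" "\<And>u. u \<in> U \<Longrightarrow> r u > 0"
  shows "Ck_on k r U \<Longrightarrow> Ck_on k (\<lambda>u. 1 / sqrt (r u)) U"
proof (induction k)
  case 0
  then show ?case using assms(2) by (auto intro!: continuous_intros) force
next
  case (Suc k)
  let ?q = "\<lambda>u. 1 / sqrt (r u)"
  have D: "(?q has_derivative (\<lambda>v. (- 1 / 2) * ((?q u * ?q u) * (?q u * D r u v)))) (at u)" if "u \<in> U" for u
  proof -
    have "r differentiable at u" using Suc(2) that by simp
    from has_derivative_D[OF this] assms(2)[OF that] show ?thesis
      by (auto intro!: derivative_eq_intros simp: field_simps fun_eq_iff)
  qed
  have "Ck_on k r U" using Suc(2) by (rule Ck_on_SucD)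
  then have "Ck_on k (\<lambda>u. (- 1 / 2) * ((?q u * ?q u) * (?q u * D r u v))) U" for v
    using Suc assms(1) by (intro Ck_on_bilinear[OF bounded_bilinear_mult] Ck_on_const Suc.IH)
      (auto dest: Ck_on_SucD)
  then have "Ck_on k (\<lambda>u. D ?q u v) U" for v
    by (rule Ck_on_cong[OF assms(1), rotated]) (use D_eqI[OF D] in auto)
  then show ?case using D by (auto simp: differentiable_def)
qed

section \<open>Symmetry of second derivatives\<close>

lemma dist_add_right_norm: "dist u (u + z) = norm z" for u z :: "'a::real_normed_vector"
  by (metis add_diff_cancel_left' dist_commute dist_norm)

lemma line_derivative:
  fixes F :: "'a::real_normed_vector \<Rightarrow> real"
  assumes "F differentiable (at (z + t *\<^sub>R w))"
  shows "((\<lambda>t. F (z + t *\<^sub>R w)) has_real_derivative D F (z + t *\<^sub>R w) w) (at t)"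
proof -
  have "((\<lambda>t. z + t *\<^sub>R w) has_derivative (\<lambda>s. s *\<^sub>R w)) (at t)"
    by (auto intro!: derivative_eq_intros)
  from has_derivative_compose[OF this has_derivative_D[OF assms]]
  have "((\<lambda>t. F (z + t *\<^sub>R w)) has_derivative (\<lambda>s. s * D F (z + t *\<^sub>R w) w)) (at t)"
    by (simp add: linear_scale[OF linear_D[OF assms]])
  then show ?thesis by (simp add: has_field_derivative_def mult_commute_abs)
qed

text \<open>The mean value theorem applied along \<open>v\<close> to a difference in
  \<open>w\<close>, and then along \<open>w\<close>. The point is that the left side is symmetric in
  \<open>v\<close> and \<open>w\<close>.\<close>

lemma second_difference:
  fixes F :: "'a::real_normed_vector \<Rightarrow> real"
  assumes U: "ball u r \<subseteq> U" and C: "Ck_on 2 F U" and h: "h > 0" "h * (norm v + norm w) < r"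
  obtains s t where "0 < s" "s < h" "0 < t" "t < h"
    "F (u + h *\<^sub>R v + h *\<^sub>R w) - F (u + h *\<^sub>R v) - F (u + h *\<^sub>R w) + F u
      = h\<^sup>2 * D (\<lambda>x. D F x v) (u + s *\<^sub>R v + t *\<^sub>R w) w"
proof -
  have inU: "u + s *\<^sub>R v + t *\<^sub>R w \<in> U" if "0 \<le> s" "s \<le> h" "0 \<le> t" "t \<le> h" for s t
  proof -
    have "norm (s *\<^sub>R v + t *\<^sub>R w) \<le> s * norm v + t * norm w"
      using norm_triangle_ineq[of "s *\<^sub>R v" "t *\<^sub>R w"] that by simp
    also have "\<dots> \<le> h * norm v + h * norm w" using that by (intro add_mono mult_right_mono) auto
    finally have "norm (s *\<^sub>R v + t *\<^sub>R w) < r" using h by (simp add: algebra_simps)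
    then have "u + (s *\<^sub>R v + t *\<^sub>R w) \<in> ball u r" by (simp add: dist_add_right_norm)
    then show ?thesis using U by (auto simp: add.assoc)
  qed
  have d1: "F differentiable (at x)" and d2: "(\<lambda>x. D F x v) differentiable (at x)" if "x \<in> U" for x
    using C that by (auto simp: numeral_2_eq_2)
  have F1: "((\<lambda>s. F (u + s *\<^sub>R v + t *\<^sub>R w)) has_real_derivative D F (u + s *\<^sub>R v + t *\<^sub>R w) v) (at s)"
    if "0 \<le> s" "s \<le> h" "0 \<le> t" "t \<le> h" for s t
    using line_derivative[OF d1, of "u + t *\<^sub>R w" s v] inU[OF that] by (simp add: ac_simps)
  have F2: "((\<lambda>t. D F (u + s *\<^sub>R v + t *\<^sub>R w) v) has_real_derivative D (\<lambda>x. D F x v) (u + s *\<^sub>R v + t *\<^sub>R w) w) (at t)"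
    if "0 \<le> s" "s \<le> h" "0 \<le> t" "t \<le> h" for s t
    using line_derivative[OF d2, of "u + s *\<^sub>R v" t w] inU[OF that] by simp
  let ?\<psi> = "\<lambda>s. F (u + s *\<^sub>R v + h *\<^sub>R w) - F (u + s *\<^sub>R v + 0 *\<^sub>R w)"
  have "\<exists>s>0. s < h \<and> ?\<psi> h - ?\<psi> 0 = (h - 0) * (D F (u + s *\<^sub>R v + h *\<^sub>R w) v - D F (u + s *\<^sub>R v + 0 *\<^sub>R w) v)"
    using h F1[of _ 0] by (intro MVT2) (auto intro!: DERIV_diff F1)
  then obtain s where s: "0 < s" "s < h"
    "?\<psi> h - ?\<psi> 0 = h * (D F (u + s *\<^sub>R v + h *\<^sub>R w) v - D F (u + s *\<^sub>R v + 0 *\<^sub>R w) v)" by auto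
  have "\<exists>t>0. t < h \<and> D F (u + s *\<^sub>R v + h *\<^sub>R w) v - D F (u + s *\<^sub>R v + 0 *\<^sub>R w) v
      = (h - 0) * D (\<lambda>x. D F x v) (u + s *\<^sub>R v + t *\<^sub>R w) w"
    using h s by (intro MVT2) (auto intro!: F2)
  then obtain t where "0 < t" "t < h" "D F (u + s *\<^sub>R v + h *\<^sub>R w) v - D F (u + s *\<^sub>R v + 0 *\<^sub>R w) v
      = h * D (\<lambda>x. D F x v) (u + s *\<^sub>R v + t *\<^sub>R w) w" by auto
  then show ?thesis using that[of s t] s by (simp add: power2_eq_square algebra_simps)
qed

text \<open>By the symmetry of the second difference the two mixed derivatives agree at some pair of
  points arbitrarily close to \<open>u\<close>; continuity brings both to \<open>u\<close>.\<close>

lemma D_commute_real: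
  fixes F :: "'a::real_normed_vector \<Rightarrow> real"
  assumes "open U" "Ck_on 2 F U" "u \<in> U"
  shows "D (\<lambda>x. D F x v) u w = D (\<lambda>x. D F x w) u v"
proof (rule ccontr)
  let ?A = "\<lambda>x. D (\<lambda>x. D F x v) x w" and ?B = "\<lambda>x. D (\<lambda>x. D F x w) x v"
  assume neq: "\<not> ?thesis"
  define e where "e = \<bar>?A u - ?B u\<bar> / 2"
  have e: "e > 0" using neq by (simp add: e_def)
  have c: "continuous_on U ?A" "continuous_on U ?B" using assms(2) by (auto simp: numeral_2_eq_2)
  obtain r where r: "r > 0" "ball u r \<subseteq> U" using assms openE by blast
  obtain d1 where d1: "d1 > 0" "\<And>x. x \<in> U \<Longrightarrow> dist x u < d1 \<Longrightarrow> dist (?A x) (?A u) < e"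
    using c(1) assms(3) e unfolding continuous_on_iff by meson
  obtain d2 where d2: "d2 > 0" "\<And>x. x \<in> U \<Longrightarrow> dist x u < d2 \<Longrightarrow> dist (?B x) (?B u) < e"
    using c(2) assms(3) e unfolding continuous_on_iff by meson
  define R where "R = min r (min d1 d2)"
  have R: "R > 0" "R \<le> r" "R \<le> d1" "R \<le> d2" using r d1 d2 by (auto simp: R_def)
  \<comment> \<open>The summand 1 keeps the denominator positive when \<open>v\<close> and
    \<open>w\<close> are zero; the factor 2 gives the strict inequality.\<close>
  define h where "h = R / (2 * (norm v + norm w + 1))"
  have np: "norm v + norm w + 1 > 0" by (meson add_nonneg_pos norm_ge_zero zero_less_one add_nonneg_nonneg)
  have h: "h > 0" using R np by (simp add: h_def)
  have hn: "h * (norm v + norm w) < R"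
  proof -
    have "h * (norm v + norm w) \<le> h * (norm v + norm w + 1)" using h by simp
    also have "\<dots> = R / 2" using np by (simp add: h_def field_simps)
    finally show ?thesis using R by simp
  qed
  have near: "u + s *\<^sub>R v + t *\<^sub>R w \<in> U \<and> dist (u + s *\<^sub>R v + t *\<^sub>R w) u < R"
    if "0 < s" "s < h" "0 < t" "t < h" for s t
  proof -
    have "norm (s *\<^sub>R v + t *\<^sub>R w) \<le> s * norm v + t * norm w"
      using norm_triangle_ineq[of "s *\<^sub>R v" "t *\<^sub>R w"] that by simp
    also have "\<dots> \<le> h * norm v + h * norm w" using that by (intro add_mono mult_right_mono) auto
    finally have *: "norm (s *\<^sub>R v + t *\<^sub>R w) < R" using hn by (simp add: algebra_simps)
    then have "u + (s *\<^sub>R v + t *\<^sub>R w) \<in> ball u r" using R by (simp add: dist_add_right_norm)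
    then show ?thesis using r * by (auto simp: add.assoc dist_norm)
  qed
  have hr: "h * (norm v + norm w) < r" "h * (norm w + norm v) < r" using hn R by (simp_all add: add.commute)
  obtain s t where st: "0 < s" "s < h" "0 < t" "t < h" and
    eq1: "F (u + h *\<^sub>R v + h *\<^sub>R w) - F (u + h *\<^sub>R v) - F (u + h *\<^sub>R w) + F u
      = h\<^sup>2 * ?A (u + s *\<^sub>R v + t *\<^sub>R w)"
    by (rule second_difference[OF r(2) assms(2) h hr(1)])
  obtain s' t' where st': "0 < s'" "s' < h" "0 < t'" "t' < h" and
    eq2: "F (u + h *\<^sub>R w + h *\<^sub>R v) - F (u + h *\<^sub>R w) - F (u + h *\<^sub>R v) + F u
      = h\<^sup>2 * ?B (u + s' *\<^sub>R w + t' *\<^sub>R v)"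
    by (rule second_difference[OF r(2) assms(2) h hr(2)])
  have swap: "u + x *\<^sub>R w + y *\<^sub>R v = u + y *\<^sub>R v + x *\<^sub>R w" for x y by simp
  have "h\<^sup>2 * ?A (u + s *\<^sub>R v + t *\<^sub>R w) = h\<^sup>2 * ?B (u + t' *\<^sub>R v + s' *\<^sub>R w)"
    using eq1 eq2 unfolding swap[of h h] swap[of s' t'] by linarith
  then have AB: "?A (u + s *\<^sub>R v + t *\<^sub>R w) = ?B (u + t' *\<^sub>R v + s' *\<^sub>R w)"
    using h(1) by simp
  have "\<bar>?A (u + s *\<^sub>R v + t *\<^sub>R w) - ?A u\<bar> < e"
    using d1(2) near[OF st] R by (force simp: dist_real_def)
  moreover have "\<bar>?B (u + t' *\<^sub>R v + s' *\<^sub>R w) - ?B u\<bar> < e"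
    using d2(2) near[OF st'(3,4) st'(1,2)] R by (force simp: dist_real_def)
  ultimately have "\<bar>?A u - ?B u\<bar> < 2 * e" using AB by linarith
  then show False by (simp add: e_def)
qed

lemma D_commute:
  fixes F :: "'a::real_normed_vector \<Rightarrow> 'b::euclidean_space"
  assumes U: "open U" and C: "Ck_on 2 F U" and u: "u \<in> U"
  shows "D (\<lambda>x. D F x v) u w = D (\<lambda>x. D F x w) u v"
proof (rule euclidean_eqI)
  fix b :: 'b assume "b \<in> Basis"
  let ?f = "\<lambda>x. inner (F x) b"
  have C2: "Ck_on 2 ?f U"
    by (intro Ck_on_bilinear[OF bounded_bilinear_inner] U C Ck_on_const)
  have d1: "F differentiable (at x)" and d2: "(\<lambda>x. D F x v) differentiable (at x)" if "x \<in> U" for x v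
    using C that by (auto simp: numeral_2_eq_2)
  have 1: "D ?f x v = inner (D F x v) b" if "x \<in> U" for x v
    using D_eqI[OF has_derivative_inner_left[OF has_derivative_D[OF d1[OF that]], of b]] by simp
  have 2: "D (\<lambda>x. D ?f x v) u w = inner (D (\<lambda>x. D F x v) u w) b" for v w
  proof -
    have h: "((\<lambda>x. inner (D F x v) b) has_derivative (\<lambda>w. inner (D (\<lambda>x. D F x v) u w) b)) (at u)"
      by (rule has_derivative_inner_left[OF has_derivative_D[OF d2[OF u]]])
    then have "D (\<lambda>x. D ?f x v) u = D (\<lambda>x. inner (D F x v) b) u"
      using D_cong(2)[OF U u, of "\<lambda>x. inner (D F x v) b" "\<lambda>x. D ?f x v"] 1
      by (auto simp: differentiable_def)
    then show ?thesis using D_eqI[OF h] by simp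
  qed
  show "inner (D (\<lambda>x. D F x v) u w) b = inner (D (\<lambda>x. D F x w) u v) b"
    using D_commute_real[OF U C2 u, of v w] by (simp add: 2)
qed

section \<open>Moving frames\<close>

text \<open>Nondegeneracy makes \<open>g\<close> an injective map into the dual space, hence a
  surjective one; \<open>?T\<close> is this map, with the dual identified through the Euclidean
  inner product.\<close>

lemma sym_form_riesz:
  fixes g :: "'a::euclidean_space \<Rightarrow> 'a \<Rightarrow> real"
  assumes g: "sym_form g" "nondegenerate g" and \<phi>: "linear \<phi>"
  obtains b where "\<And>w. g b w = \<phi> w"
proof -
  note simps = sym_form_simps[OF g(1)]
  let ?T = "\<lambda>v. \<Sum>b\<in>Basis. g v b *\<^sub>R b"
  have expand: "linear \<psi> \<Longrightarrow> \<psi> w = (\<Sum>b\<in>Basis. \<psi> b * inner b w)" for \<psi> :: "'a \<Rightarrow> real" and w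
    by (subst euclidean_representation[of w, symmetric])
      (simp add: linear_sum linear_scale inner_commute mult.commute)
  have gT: "g v w = inner (?T v) w" for v w
    using expand[of "g v" w] g(1) by (simp add: inner_sum_left sym_form_def bilinear_def)
  have lin: "linear ?T"
    by (rule linearI) (auto simp: simps algebra_simps scaleR_sum_right sum.distrib)
  have "inj ?T"
    using linear_injective_0[OF lin] gT g(2) unfolding nondegenerate_def by (metis inner_zero_left)
  then have "surj ?T" by (rule linear_injective_imp_surjective[OF lin _ refl])
  from surjD[OF this, of "\<Sum>c\<in>Basis. \<phi> c *\<^sub>R c"]
  obtain b where b: "(\<Sum>c\<in>Basis. \<phi> c *\<^sub>R c) = ?T b" ..
  have "g b w = \<phi> w" for w
    using gT[of b w] expand[OF \<phi>, of w] by (simp add: inner_sum_left flip: b)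
  then show ?thesis by (rule that)
qed

text \<open>A Euclidean normal to a proper span is represented through \<open>G\<close> by some
  \<open>V\<close>, which is then \<open>G\<close>-orthogonal to \<open>S\<close>. So spanning can
  be tested with the indefinite form.\<close>

lemma span_UNIV_if_complement_trivial:
  fixes G :: "'a::euclidean_space \<Rightarrow> 'a \<Rightarrow> real"
  assumes G: "sym_form G" "nondegenerate G"
    and triv: "\<And>V. (\<And>s. s \<in> S \<Longrightarrow> G V s = 0) \<Longrightarrow> V = 0"
  shows "span S = UNIV"
proof (rule ccontr)
  assume "span S \<noteq> UNIV"
  then obtain n where n: "n \<noteq> 0" "\<forall>x\<in>span S. inner n x = 0"
    using span_not_UNIV_orthogonal by blast
  obtain V where V: "\<And>w. G V w = inner n w"
    using sym_form_riesz[OF G, of "inner n"] bounded_linear_inner_right bounded_linear.linear by blast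
  then have "V = 0" using n by (intro triv) (simp add: span_base)
  then have "inner n n = 0" using V[of n] by (simp add: sym_form_simps[OF G(1)])
  then show False using n by simp
qed

text \<open>\<open>A\<^sub>0\<close>, the \<open>A\<^sub>i\<close> (as the linear map \<open>P\<close>), and \<open>A\<^sub>n\<close>, where \<open>A\<^sub>n\<close> has square \<open>e\<close>.\<close>

definition tangent_frame :: "('b::euclidean_space \<Rightarrow> 'b \<Rightarrow> real) \<Rightarrow> 'b \<Rightarrow> ('a::euclidean_space \<Rightarrow> 'b) \<Rightarrow> 'b \<Rightarrow> real \<Rightarrow> bool" where
  "tangent_frame G X P N e \<longleftrightarrow> linear P \<and> X \<noteq> 0 \<and> G X X = 0 \<and> (\<forall>v. G X (P v) = 0) \<and>
     nondegenerate (\<lambda>v w. G (P v) (P w)) \<and> e \<noteq> 0 \<and> G N N = e \<and> G N X = 0 \<and> (\<forall>v. G N (P v) = 0)"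

definition frame_map :: "'b \<Rightarrow> ('a \<Rightarrow> 'b) \<Rightarrow> 'b \<Rightarrow> 'b \<Rightarrow> real \<times> 'a \<times> real \<times> real \<Rightarrow> 'b::real_vector" where
  "frame_map X P N Z = (\<lambda>(a, b, c, d). a *\<^sub>R X + P b + c *\<^sub>R N + d *\<^sub>R Z)"

text \<open>\<open>Z\<close> is the second isotropic vertex of the conformal frame, dual to
  \<open>X\<close>; by the dimension hypothesis the frame is then complete.\<close>

locale full_frame =
  fixes G :: "'b::euclidean_space \<Rightarrow> 'b \<Rightarrow> real" and X :: 'b and P :: "'a::euclidean_space \<Rightarrow> 'b"
    and N :: 'b and e :: real and Z :: 'b
  assumes G: "sym_form G" and dim: "DIM('b) = DIM('a) + 3"
    and tf: "tangent_frame G X P N e"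
    and Z: "G X Z = 1" "G Z Z = 0" "G N Z = 0" "\<And>v. G (P v) Z = 0"
begin

lemmas simps = sym_form_simps[OF G]

lemma gram:
  "linear P" "G X X = 0" "G X (P v) = 0" "G (P v) X = 0" "G N N = e" "e \<noteq> 0"
  "G N X = 0" "G X N = 0" "G N (P v) = 0" "G (P v) N = 0"
  "G X Z = 1" "G Z X = 1" "G Z Z = 0" "G N Z = 0" "G Z N = 0" "G (P v) Z = 0" "G Z (P v) = 0"
  using tf Z sym_form_commute[OF G] unfolding tangent_frame_def by metis+

lemma gram_frame_map:
  "G (frame_map X P N Z (a, b, c, d)) (frame_map X P N Z (a', b', c', d'))
    = a * d' + d * a' + G (P b) (P b') + e * c * c'"
  by (simp add: frame_map_def simps gram algebra_simps)

lemma linear_frame_map: "linear (frame_map X P N Z)"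
  by (rule linearI) (auto simp: frame_map_def linear_add[OF gram(1)] linear_scale[OF gram(1)] algebra_simps)

lemma bij_frame_map: "bij (frame_map X P N Z)"
proof -
  let ?T = "frame_map X P N Z"
  have "p = 0" if p: "?T p = 0" for p
  proof -
    obtain a b c d where abcd: "p = (a, b, c, d)" by (cases p)
    have z: "G (?T (a, b, c, d)) W = 0" for W using p abcd by (simp add: simps)
    \<comment> \<open>\<open>X\<close> and \<open>Z\<close> span a hyperbolic plane, so pairing with
      one reads off the coefficient of the other.\<close>
    have "d = 0" using z[of X] by (simp add: frame_map_def simps gram)
    moreover have "a = 0" using z[of Z] by (simp add: frame_map_def simps gram)
    moreover have "c = 0" using z[of N] by (simp add: frame_map_def simps gram)
    moreover have "G (P b) (P v) = 0" for v using z[of "P v"] by (simp add: frame_map_def simps gram)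
    then have "b = 0" using tf unfolding tangent_frame_def nondegenerate_def by blast
    ultimately show "p = 0" by (simp add: abcd zero_prod_def)
  qed
  then have inj: "inj ?T" using linear_injective_0[OF linear_frame_map] by blast
  moreover have "surj ?T"
    using dim by (intro linear_injective_imp_surjective[OF linear_frame_map inj]) simp
  ultimately show ?thesis by (simp add: bij_def)
qed

text \<open>Since \<open>X\<close> is isotropic it lies in its own complement, so a vector
  orthogonal to \<open>X\<close> and the tangent vectors keeps two components. All defects below are
  reduced to two scalars in this way.\<close>

lemma complement:
  assumes "G V X = 0" "\<And>v. G V (P v) = 0"
  shows "V = G V Z *\<^sub>R X + (G V N / e) *\<^sub>R N"
proof -
  obtain a b c d where V: "V = frame_map X P N Z (a, b, c, d)"
    using bij_frame_map by (metis bij_pointE surj_pair)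
  have "d = 0" using assms(1) unfolding V by (simp add: frame_map_def simps gram)
  have "G (P b) (P v) = 0" for v using assms(2)[of v] unfolding V by (simp add: frame_map_def simps gram)
  then have "b = 0" using tf unfolding tangent_frame_def nondegenerate_def by blast
  then have "P b = 0" using gram(1) by (simp add: linear_0)
  with \<open>d = 0\<close> show ?thesis using gram(6) unfolding V by (simp add: frame_map_def simps gram)
qed

end

text \<open>Gram-Schmidt on any vector not orthogonal to \<open>X\<close>: remove its tangential and
  normal parts, scale its pairing with \<open>X\<close> to 1, then correct its square by a multiple
  of \<open>X\<close>, which spoils none of the other pairings.\<close>

lemma full_frame_exists:
  fixes G :: "'b::euclidean_space \<Rightarrow> 'b \<Rightarrow> real" and P :: "'a::euclidean_space \<Rightarrow> 'b"
  assumes G: "sym_form G" "nondegenerate G" and dim: "DIM('b) = DIM('a) + 3"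
    and tf: "tangent_frame G X P N e"
  obtains Z where "full_frame G X P N e Z"
proof -
  note simps = sym_form_simps[OF G(1)]
  have t: "linear P" "X \<noteq> 0" "G X X = 0" "G X (P v) = 0" "nondegenerate (\<lambda>v w. G (P v) (P w))" "e \<noteq> 0"
    "G N N = e" "G N X = 0" "G N (P v) = 0" for v
    using tf by (auto simp: tangent_frame_def)
  obtain Z0 where Z0: "G X Z0 \<noteq> 0" using G(2) t(2) unfolding nondegenerate_def by blast
  have "linear (\<lambda>v. G Z0 (P v))"
    by (rule linearI) (auto simp: simps linear_add[OF t(1)] linear_scale[OF t(1)])
  then obtain b where b: "\<And>w. G (P b) (P w) = G Z0 (P w)"
    using sym_form_riesz[OF sym_form_pullback[OF G(1) t(1)] t(5)] by blast
  define Z1 where "Z1 = (1 / G X Z0) *\<^sub>R (Z0 - P b - (G N Z0 / e) *\<^sub>R N)"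
  have t': "G X N = 0" "G (P v) N = 0" "G (P v) X = 0" for v
    using t sym_form_commute[OF G(1)] by metis+
  have Z1: "G X Z1 = 1" "G N Z1 = 0"
    using Z0 t t' by (auto simp: Z1_def simps)
  have Z1P: "G (P v) Z1 = 0" for v
    using b[of v] sym_form_commute[OF G(1), of "P v"] by (simp add: Z1_def simps t')
  have Z1X: "G Z1 X = 1" using Z1(1) sym_form_commute[OF G(1)] by metis
  define Z where "Z = Z1 - (G Z1 Z1 / 2) *\<^sub>R X"
  have "full_frame G X P N e Z"
    using G(1) dim tf
    by unfold_locales (simp_all add: Z_def simps Z1 Z1P Z1X t t')
  then show ?thesis by (rule that)
qed

text \<open>Both frames have the same Gram matrix, so equal coordinates define an isometry. Allowing
  \<open>G'\<close> to differ from \<open>G\<close> is what admits anti-isometries.\<close>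

lemma frame_isometry:
  assumes F: "full_frame G X P N e Z" and F': "full_frame G' X' P' N' e Z'"
    and metric: "\<And>v w. G (P v) (P w) = G' (P' v) (P' w)"
  obtains L where "linear L" "\<And>v w. G' (L v) (L w) = G v w" "L X = X'" "\<And>v. L (P v) = P' v"
    "L N = N'" "L Z = Z'"
proof -
  interpret F: full_frame G X P N e Z by fact
  interpret F': full_frame G' X' P' N' e Z' by fact
  let ?T = "frame_map X P N Z" and ?T' = "frame_map X' P' N' Z'"
  obtain R where R: "linear R" "R \<circ> ?T = id"
    using linear_injective_left_inverse[OF F.linear_frame_map] F.bij_frame_map by (auto simp: bij_def)
  let ?L = "?T' \<circ> R"
  have LT: "?L (?T p) = ?T' p" for p using fun_cong[OF R(2), of p] by simp
  have lin: "linear ?L"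
    by (rule linear_compose[OF R(1) F'.linear_frame_map])
  have P0: "P 0 = 0" "P' 0 = 0" using F.gram(1) F'.gram(1) by (auto simp: linear_0)
  have "G' (?L v) (?L w) = G v w" for v w
  proof -
    obtain p q where pq: "v = ?T p" "w = ?T q" using F.bij_frame_map by (metis bij_pointE)
    then show ?thesis unfolding pq LT
      by (cases p; cases q) (simp only: F.gram_frame_map F'.gram_frame_map metric)
  qed
  moreover have "?L X = X'" using LT[of "(1, 0, 0, 0)"] by (simp add: frame_map_def P0)
  moreover have "?L (P v) = P' v" for v using LT[of "(0, v, 0, 0)"] by (simp add: frame_map_def P0)
  moreover have "?L N = N'" using LT[of "(0, 0, 1, 0)"] by (simp add: frame_map_def P0)
  moreover have "?L Z = Z'" using LT[of "(0, 0, 0, 1)"] by (simp add: frame_map_def P0)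
  ultimately show ?thesis using lin that by blast
qed

lemma tangent_frame_isometry:
  assumes tf: "tangent_frame G X P N e" and L: "linear L" "\<And>v w. G' (L v) (L w) = G v w"
    and "L X \<noteq> 0"
  shows "tangent_frame G' (L X) (\<lambda>v. L (P v)) (L N) e"
  using assms linear_compose[of P L] by (auto simp: tangent_frame_def o_def)

section \<open>Constancy of the map between two moving frames\<close>

lemma differentiable_det:
  fixes A :: "'a::real_normed_vector \<Rightarrow> real^'n^'n"
  assumes "\<And>i j. (\<lambda>u. A u $ i $ j) differentiable (at u0)"
  shows "(\<lambda>u. det (A u)) differentiable (at u0)"
proof -
  have p: "(\<lambda>u. \<Prod>i\<in>UNIV. A u $ i $ p i) differentiable (at u0)" for p
  proof -
    have "\<exists>d. ((\<lambda>u. A u $ i $ p i) has_derivative d) (at u0)" for i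
      using assms unfolding differentiable_def by blast
    then obtain d where "\<And>i. ((\<lambda>u. A u $ i $ p i) has_derivative d i) (at u0)" by metis
    then show ?thesis unfolding differentiable_def by (intro exI) (rule has_derivative_prod)
  qed
  show ?thesis
    unfolding det_def
    by (intro differentiable_sum ballI differentiable_mult differentiable_const p) simp
qed

text \<open>If \<open>L u\<close> carries a moving frame to another one and also their derivatives, then
  differentiating \<open>L u (F u) = F' u\<close> gives \<open>dL = 0\<close>.  Cramer's rule provides the
  differentiability of \<open>L\<close>.\<close>

lemma moving_frame_map_stationary:
  fixes L :: "'a::real_normed_vector \<Rightarrow> real^'m \<Rightarrow> 'b::real_normed_vector"
    and FF :: "(('a \<Rightarrow> real^'m) \<times> ('a \<Rightarrow> 'b)) set"
  assumes U: "open U" "u0 \<in> U"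
    and lin: "\<And>u. u \<in> U \<Longrightarrow> linear (L u)"
    and diff: "\<And>F F'. (F, F') \<in> FF \<Longrightarrow> F differentiable (at u0)"
      "\<And>F F'. (F, F') \<in> FF \<Longrightarrow> F' differentiable (at u0)"
    and LF: "\<And>F F' u. (F, F') \<in> FF \<Longrightarrow> u \<in> U \<Longrightarrow> L u (F u) = F' u"
    and LD: "\<And>F F' v. (F, F') \<in> FF \<Longrightarrow> L u0 (D F u0 v) = D F' u0 v"
    and span: "span {F u0 |F F'. (F, F') \<in> FF} = UNIV"
  shows "((\<lambda>u. L u a) has_derivative (\<lambda>_. 0)) (at u0)"
proof -
  let ?S = "{F u0 |F F'. (F, F') \<in> FF}"
  obtain Bs where Bs: "Bs \<subseteq> ?S" "independent Bs" "?S \<subseteq> span Bs" "card Bs = dim ?S"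
    using basis_exists by blast
  have "UNIV \<subseteq> span Bs" using span_mono[OF Bs(3)] by (simp only: span span_span)
  then have spanB: "span Bs = UNIV" by (rule top.extremum_uniqueI)
  have "dim ?S = dim (span ?S)" by (rule dim_span[symmetric])
  also have "\<dots> = CARD('m)" by (simp only: span) simp
  finally have "card (UNIV :: 'm set) = card Bs" using Bs(4) by simp
  then obtain \<beta> where \<beta>: "bij_betw \<beta> (UNIV :: 'm set) Bs"
    using finite_same_card_bij[OF finite independent_imp_finite[OF Bs(2)]] by blast
  then have "\<exists>F F'. (F, F') \<in> FF \<and> \<beta> i = F u0" for i
    using Bs(1) bij_betwE[OF \<beta>] by blast
  then obtain F F' where F: "\<And>i. (F i, F' i) \<in> FF" "\<And>i. \<beta> i = F i u0" by metis
  define E where "E u = (\<chi> r i. F i u $ r)" for u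
  have Ew: "E u *v w = (\<Sum>i\<in>UNIV. (w $ i) *\<^sub>R F i u)" for u w
    by (simp add: E_def matrix_vector_mult_def vec_eq_iff mult.commute)
  have comp: "(\<lambda>u. F i u $ r) differentiable (at u0)" for i r
    by (rule differentiableI[OF bounded_linear.has_derivative[OF bounded_linear_vec_nth
            has_derivative_D[OF diff(1)[OF F(1)]]]])
  have dE: "(\<lambda>u. det (E u)) differentiable (at u0)"
    by (rule differentiable_det) (simp add: E_def comp)
  have "columns (E u0) = Bs"
    using \<beta> by (auto simp: columns_def column_def E_def vec_lambda_eta F(2) bij_betw_def)
  then have "invertible (E u0)"
    using spanB by (simp add: invertible_right_inverse matrix_right_invertible_span_columns span_vec_eq)
  then have det0: "det (E u0) \<noteq> 0" by (simp add: invertible_det_nz)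
  \<comment> \<open>The coordinates of the fixed vector \<open>a\<close> in the moving basis; as
    quotients of determinants they are differentiable.\<close>
  define w where "w u = (\<chi> k. det (\<chi> i j. if j = k then a $ i else E u $ i $ j) / det (E u))" for u
  have "(\<lambda>u. det (\<chi> i j. if j = k then a $ i else E u $ i $ j)) differentiable (at u0)" for k
  proof (rule differentiable_det)
    fix i j
    show "(\<lambda>u. (\<chi> i j. if j = k then a $ i else E u $ i $ j) $ i $ j) differentiable (at u0)"
      by (cases "j = k") (simp_all add: E_def comp)
  qed
  then have "(\<lambda>u. w u $ k) differentiable (at u0)" for k
    unfolding w_def using dE det0 by (auto intro!: differentiable_divide)
  then obtain w' where w': "\<And>k. ((\<lambda>u. w u $ k) has_derivative w' k) (at u0)"
    unfolding differentiable_def by metis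
  have "isCont (\<lambda>u. det (E u)) u0"
    using dE differentiable_imp_continuous_within by blast
  then have ev: "eventually (\<lambda>u. det (E u) \<noteq> 0) (at u0)"
    using det0 unfolding isCont_def by (rule tendsto_imp_eventually_ne)
  have solve: "a = (\<Sum>i\<in>UNIV. (w u $ i) *\<^sub>R F i u)" if "det (E u) \<noteq> 0" for u
    using iffD2[OF cramer[OF that] w_def] by (simp add: Ew)
  have expand: "eventually (\<lambda>u. a = (\<Sum>i\<in>UNIV. (w u $ i) *\<^sub>R F i u)) (at u0)"
    using ev by eventually_elim (rule solve)
  note expand0 = solve[OF det0]
  have dF: "((\<lambda>u. \<Sum>i\<in>UNIV. (w u $ i) *\<^sub>R F i u) has_derivative
      (\<lambda>v. \<Sum>i\<in>UNIV. (w u0 $ i) *\<^sub>R D (F i) u0 v + w' i v *\<^sub>R F i u0)) (at u0)"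
    by (intro has_derivative_sum has_derivative_scaleR w' has_derivative_D diff(1)[OF F(1)])
  have dF': "((\<lambda>u. \<Sum>i\<in>UNIV. (w u $ i) *\<^sub>R F' i u) has_derivative
      (\<lambda>v. \<Sum>i\<in>UNIV. (w u0 $ i) *\<^sub>R D (F' i) u0 v + w' i v *\<^sub>R F' i u0)) (at u0)"
    by (intro has_derivative_sum has_derivative_scaleR w' has_derivative_D diff(2)[OF F(1)])
  have const: "((\<lambda>u. a) has_derivative
      (\<lambda>v. \<Sum>i\<in>UNIV. (w u0 $ i) *\<^sub>R D (F i) u0 v + w' i v *\<^sub>R F i u0)) (at u0)"
    by (rule has_derivative_transform_eventually[OF dF]) (use expand expand0 in \<open>auto simp: eq_commute\<close>)
  \<comment> \<open>The derivative of the constant \<open>a\<close> in moving coordinates. Applying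
    \<open>L u0\<close> to this equation turns it, by \<open>LF\<close> and \<open>LD\<close>, into
    the derivative of \<open>L u a\<close>.\<close>
  have zero: "(\<Sum>i\<in>UNIV. (w u0 $ i) *\<^sub>R D (F i) u0 v + w' i v *\<^sub>R F i u0) = 0" for v
    by (rule fun_cong[OF has_derivative_unique[OF const has_derivative_const]])
  note L0 = lin[OF U(2)]
  have zero': "(\<Sum>i\<in>UNIV. (w u0 $ i) *\<^sub>R D (F' i) u0 v + w' i v *\<^sub>R F' i u0) = 0" for v
    using arg_cong[OF zero[of v], of "L u0"]
    by (simp add: linear_0[OF L0] linear_sum[OF L0] linear_add[OF L0] linear_scale[OF L0]
        LD[OF F(1)] LF[OF F(1) U(2)])
  have La: "L u a = (\<Sum>i\<in>UNIV. (w u $ i) *\<^sub>R F' i u)"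
    if "u \<in> U" "a = (\<Sum>i\<in>UNIV. (w u $ i) *\<^sub>R F i u)" for u
  proof -
    have "L u a = L u (\<Sum>i\<in>UNIV. (w u $ i) *\<^sub>R F i u)" using that(2) by simp
    also have "\<dots> = (\<Sum>i\<in>UNIV. (w u $ i) *\<^sub>R F' i u)"
      by (simp add: linear_sum[OF lin[OF that(1)]] linear_scale[OF lin[OF that(1)]] LF[OF F(1) that(1)])
    finally show ?thesis .
  qed
  have "eventually (\<lambda>u. u \<in> U) (at u0)" using U by (rule eventually_at_in_open')
  then have "eventually (\<lambda>u. (\<Sum>i\<in>UNIV. (w u $ i) *\<^sub>R F' i u) = L u a) (at u0)"
    using expand by eventually_elim (rule La[symmetric])
  from has_derivative_transform_eventually[OF dF' this] La[OF U(2) expand0] show ?thesis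
    by (simp add: zero')
qed

section \<open>Rigidity\<close>

abbreviation D2 :: "('a::real_normed_vector \<Rightarrow> 'b::real_normed_vector) \<Rightarrow> 'a \<Rightarrow> 'a \<Rightarrow> 'a \<Rightarrow> 'b" where
  "D2 F u v w \<equiv> D (\<lambda>x. D F x v) u w"

abbreviation D3 :: "('a::real_normed_vector \<Rightarrow> 'b::real_normed_vector) \<Rightarrow> 'a \<Rightarrow> 'a \<Rightarrow> 'a \<Rightarrow> 'a \<Rightarrow> 'b" where
  "D3 F u v w z \<equiv> D (\<lambda>x. D2 F x v w) u z"

lemma Ck_on_3D:
  assumes "Ck_on 3 F U" "u \<in> U"
  shows "F differentiable (at u)" "(\<lambda>x. D F x v) differentiable (at u)"
    "(\<lambda>x. D2 F x v w) differentiable (at u)"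
  using assms by (auto simp: numeral_3_eq_3)

lemma higher_D_symmetries:
  fixes F :: "'a::real_normed_vector \<Rightarrow> 'b::euclidean_space"
  assumes U: "open U" and F: "Ck_on 3 F U" and u: "u \<in> U"
  shows "D2 F u v w = D2 F u w v" "D3 F u v w z = D3 F u w v z" "D3 F u v w z = D3 F u v z w"
proof -
  have F2: "Ck_on 2 F U" using F by (rule Ck_on_mono) simp
  have sym: "D2 F x v w = D2 F x w v" if "x \<in> U" for x v w using D_commute[OF U F2 that] .
  then show "D2 F u v w = D2 F u w v" using u .
  show "D3 F u v w z = D3 F u w v z"
    using D_cong(2)[OF U u sym Ck_on_3D(3)[OF F u]] by simp
  have "Ck_on 2 (\<lambda>x. D F x v) U" using F by (simp add: numeral_3_eq_3 numeral_2_eq_2)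
  then show "D3 F u v w z = D3 F u v z w" by (rule D_commute[OF U _ u])
qed

lemma linear_D2:
  fixes F :: "'a::real_normed_vector \<Rightarrow> 'b::euclidean_space"
  assumes U: "open U" and F: "Ck_on 3 F U" and u: "u \<in> U"
  shows "linear (D2 F u v)" "linear (\<lambda>v. D2 F u v w)"
proof -
  show l: "linear (D2 F u v)" for v by (rule linear_D[OF Ck_on_3D(2)[OF F u]])
  have "D2 F u w = (\<lambda>v. D2 F u v w)" using higher_D_symmetries(1)[OF U F u] by blast
  with l[of w] show "linear (\<lambda>v. D2 F u v w)" by simp
qed

lemma has_derivative_pairing:
  fixes G :: "'b::euclidean_space \<Rightarrow> 'b \<Rightarrow> real"
  assumes "sym_form G" "F differentiable (at u)" "H differentiable (at u)"
  shows "((\<lambda>x. G (F x) (H x)) has_derivative (\<lambda>z. G (F u) (D H u z) + G (D F u z) (H u))) (at u)"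
  by (rule bounded_bilinear.FDERIV[OF sym_form_bounded_bilinear[OF assms(1)]
        has_derivative_D[OF assms(2)] has_derivative_D[OF assms(3)]])

text \<open>The basic move of the local argument. With zero functions on the right it differentiates
  the vanishing of a pairing.\<close>

lemma differentiate_pairing:
  fixes G :: "'b::euclidean_space \<Rightarrow> 'b \<Rightarrow> real" and G' :: "'c::euclidean_space \<Rightarrow> 'c \<Rightarrow> real"
  assumes G: "sym_form G" "sym_form G'" and U: "open U" "u \<in> U"
    and d: "F differentiable (at u)" "H differentiable (at u)"
      "F' differentiable (at u)" "H' differentiable (at u)"
    and eq: "\<And>x. x \<in> U \<Longrightarrow> G (F x) (H x) = G' (F' x) (H' x)"
  shows "G (F u) (D H u z) + G (D F u z) (H u) = G' (F' u) (D H' u z) + G' (D F' u z) (H' u)"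
proof -
  note * = has_derivative_transform_within_open[OF has_derivative_pairing[OF G(1) d(1,2)] U eq]
  show ?thesis
    using has_derivative_unique[OF * has_derivative_pairing[OF G(2) d(3,4)]] by meson
qed

section \<open>A single parametrized nonisotropic hypersurface\<close>

locale null_lift =
  fixes G :: "real^'m::finite \<Rightarrow> real^'m \<Rightarrow> real" and U :: "'a::euclidean_space set" and X :: "'a \<Rightarrow> real^'m"
  assumes G: "sym_form G" "nondegenerate G" and U: "open U" and X: "Ck_on 3 X U"
    and null: "\<And>u. u \<in> U \<Longrightarrow> G (X u) (X u) = 0" and nonzero: "\<And>u. u \<in> U \<Longrightarrow> X u \<noteq> 0"
    and dim: "CARD('m) = DIM('a) + 3" "DIM('a) \<ge> 3"
    and nd: "\<And>u. u \<in> U \<Longrightarrow> nondegenerate (\<lambda>v w. G (D X u v) (D X u w))"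
begin

lemmas simps = sym_form_simps[OF G(1)]
lemmas diff = Ck_on_3D[OF X]
lemmas sym = higher_D_symmetries[OF U X]

lemma linX: "u \<in> U \<Longrightarrow> linear (D X u)"
  by (rule linear_D[OF diff(1)])

lemma metric_sym_form: "u \<in> U \<Longrightarrow> sym_form (\<lambda>v w. G (D X u v) (D X u w))"
  by (rule sym_form_pullback[OF G(1) linX])

lemma X_perp_D: assumes "u \<in> U" shows "G (X u) (D X u v) = 0"
proof -
  have "G (X u) (D X u v) + G (D X u v) (X u) = 0"
    using differentiate_pairing[OF G(1) G(1) U assms diff(1)[OF assms] diff(1)[OF assms], of "\<lambda>_. 0" "\<lambda>_. 0"] null
    by (simp add: simps)
  then show ?thesis using sym_form_commute[OF G(1), of "X u"] by simp
qed

text \<open>Differentiate (X, dX) = 0. Thus the metric is to \<open>X\<close> what the second form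
  is to the normal: a component of the second derivatives.\<close>

lemma D2_X: assumes "u \<in> U" shows "G (D2 X u v w) (X u) = - G (D X u v) (D X u w)"
proof -
  have "G (X u) (D2 X u v w) + G (D X u w) (D X u v) = 0"
    using differentiate_pairing[OF G(1) G(1) U assms diff(1)[OF assms] diff(2)[OF assms], of "\<lambda>_. 0" "\<lambda>_. 0"] X_perp_D
    by (simp add: simps)
  then show ?thesis
    using sym_form_commute[OF G(1), of "X u" "D2 X u v w"]
      sym_form_commute[OF G(1), of "D X u w" "D X u v"] by linarith
qed

lemma tangent_frameI:
  assumes "u \<in> U" "e \<noteq> 0" "G N N = e" "G N (X u) = 0" "\<And>v. G N (D X u v) = 0"
  shows "tangent_frame G (X u) (D X u) N e"
  using assms linX null nonzero nd X_perp_D by (auto simp: tangent_frame_def)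

text \<open>By \<open>D2_X\<close>, replacing \<open>N\<close> by \<open>N + t X\<close> only adds a
  multiple of the metric, so the condition is one on the whole pencil of tangent
  hyperspheres.\<close>

definition nonumbilic :: "'a \<Rightarrow> real^'m \<Rightarrow> bool" where
  "nonumbilic u N \<longleftrightarrow> (\<nexists>\<kappa>. \<forall>v w. G (D2 X u v w) N = \<kappa> * G (D X u v) (D X u w))"

text \<open>Orthogonality to X and dX leaves \<open>V = a X + c N\<close>; pairing with the second
  derivatives gives c h = a g, which independence of g and h excludes unless both coefficients
  vanish.\<close>

lemma jet_complement_trivial:
  assumes u: "u \<in> U" and tf: "tangent_frame G (X u) (D X u) N e" and nu: "nonumbilic u N"
    and V: "G V (X u) = 0" "\<And>v. G V (D X u v) = 0" "\<And>v w. G V (D2 X u v w) = 0"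
  shows "V = 0"
proof -
  have dim': "DIM(real^'m) = DIM('a) + 3" using dim by simp
  obtain Z where "full_frame G (X u) (D X u) N e Z" using full_frame_exists[OF G dim' tf] .
  then interpret full_frame G "X u" "D X u" N e Z .
  define a where "a = G V Z"
  define c where "c = G V N / e"
  have Ve: "V = a *\<^sub>R X u + c *\<^sub>R N" using complement[OF V(1,2)] by (simp add: a_def c_def)
  have e: "c * G (D2 X u v w) N = a * G (D X u v) (D X u w)" for v w
    using V(3)[of v w] D2_X[OF u, of v w] sym_form_commute[OF G(1), of "D2 X u v w"]
    unfolding Ve by (simp add: simps)
  have "c = 0"
  proof (rule ccontr)
    assume "c \<noteq> 0"
    then have "G (D2 X u v w) N = (a / c) * G (D X u v) (D X u w)" for v w
      using e[of v w] by (simp add: field_simps)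
    then show False using nu unfolding nonumbilic_def by blast
  qed
  moreover obtain b where "G (D X u b) (D X u b) \<noteq> 0"
    using nondegenerate_nonnull[OF metric_sym_form[OF u] nd[OF u]] .
  ultimately have "a = 0" using e[of b b] by simp
  with \<open>c = 0\<close> show ?thesis by (simp add: Ve)
qed

lemma jet_span:
  assumes u: "u \<in> U" and tf: "tangent_frame G (X u) (D X u) N e" and nu: "nonumbilic u N"
  shows "span (insert (X u) (range (D X u) \<union> {D2 X u v w |v w. True})) = UNIV"
  by (rule span_UNIV_if_complement_trivial[OF G], rule jet_complement_trivial[OF assms]) blast+

end

section \<open>Two lifts with the same metric and the same second form\<close>

locale congruent_lifts = X: null_lift G U X + Y: null_lift G' U Y
  for G G' :: "real^'m::finite \<Rightarrow> real^'m \<Rightarrow> real" and U :: "'a::euclidean_space set" and X Y :: "'a \<Rightarrow> real^'m" +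
  assumes metric: "\<And>u v w. u \<in> U \<Longrightarrow> G (D X u v) (D X u w) = G' (D Y u v) (D Y u w)"
    and normals: "\<And>u. u \<in> U \<Longrightarrow> \<exists>N N' e. tangent_frame G (X u) (D X u) N e \<and>
      tangent_frame G' (Y u) (D Y u) N' e \<and> X.nonumbilic u N \<and>
      (\<forall>v w. G (D2 X u v w) N = G' (D2 Y u v w) N')"
begin

text \<open>As in the uniqueness of the Levi-Civita connection: the difference \<open>c\<close> is
  symmetric in its first two arguments and, by differentiating the metric, antisymmetric in the
  first and third, so it vanishes.\<close>

lemma christoffel:
  assumes u: "u \<in> U"
  shows "G (D2 X u v w) (D X u z) = G' (D2 Y u v w) (D Y u z)"
proof -
  define c where "c v w z = G (D2 X u v w) (D X u z) - G' (D2 Y u v w) (D Y u z)" for v w z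
  have "c v t w + c w t v = 0" for v w t
    using differentiate_pairing[OF X.G(1) Y.G(1) X.U u X.diff(2)[OF u] X.diff(2)[OF u] Y.diff(2)[OF u]
        Y.diff(2)[OF u] metric, of v w t]
      sym_form_commute[OF X.G(1), of "D X u v"] sym_form_commute[OF Y.G(1), of "D Y u v"]
    by (simp add: c_def)
  moreover have "c v t w = c t v w" for v w t
    by (simp add: c_def X.sym(1)[OF u, of v t] Y.sym(1)[OF u, of v t])
  ultimately have "c v w z = 0"
    by (smt (verit))
  then show ?thesis by (simp add: c_def)
qed

lemma christoffel_derivative:
  assumes u: "u \<in> U"
  shows "G (D2 X u v w) (D2 X u z t) + G (D3 X u v w t) (D X u z)
    = G' (D2 Y u v w) (D2 Y u z t) + G' (D3 Y u v w t) (D Y u z)"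
  by (rule differentiate_pairing[OF X.G(1) Y.G(1) X.U u X.diff(3)[OF u] X.diff(2)[OF u] Y.diff(3)[OF u]
        Y.diff(2)[OF u] christoffel])

text \<open>Either side is a combination of second derivatives of the common metric, as in the Gauss equation.\<close>

lemma gauss:
  assumes u: "u \<in> U"
  shows "G (D2 X u v w) (D2 X u z t) - G (D2 X u v t) (D2 X u z w)
    = G' (D2 Y u v w) (D2 Y u z t) - G' (D2 Y u v t) (D2 Y u z w)"
  using christoffel_derivative[OF u, of v w z t] christoffel_derivative[OF u, of v t z w]
    X.sym(3)[OF u, of v w t] Y.sym(3)[OF u, of v w t] by simp

lemma D2_X_eq: "u \<in> U \<Longrightarrow> G (D2 X u v w) (X u) = G' (D2 Y u v w) (Y u)"
  by (simp add: X.D2_X Y.D2_X metric)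

definition jet_isometry :: "'a \<Rightarrow> (real^'m \<Rightarrow> real^'m) \<Rightarrow> bool" where
  "jet_isometry u L \<longleftrightarrow> linear L \<and> (\<forall>a b. G' (L a) (L b) = G a b) \<and> L (X u) = Y u \<and>
     (\<forall>v. L (D X u v) = D Y u v) \<and> (\<forall>v w. L (D2 X u v w) = D2 Y u v w)"

text \<open>A priori the second derivatives correspond only up to multiples \<open>s\<close> of \<open>Y\<close>; the Gauss
  equation says \<open>g \<and> s = 0\<close>.\<close>

lemma jet_isometry_exists:
  assumes u: "u \<in> U"
  obtains L where "jet_isometry u L"
proof -
  note GG = X.simps Y.simps
  have dim': "DIM(real^'m) = DIM('a) + 3" using X.dim by simp
  obtain N N' e where tf: "tangent_frame G (X u) (D X u) N e" "tangent_frame G' (Y u) (D Y u) N' e"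
    and h: "\<And>v w. G (D2 X u v w) N = G' (D2 Y u v w) N'" using normals[OF u] by blast
  obtain Z where Z: "full_frame G (X u) (D X u) N e Z" using full_frame_exists[OF X.G dim' tf(1)] .
  obtain Z' where Z': "full_frame G' (Y u) (D Y u) N' e Z'" using full_frame_exists[OF Y.G dim' tf(2)] .
  interpret F': full_frame G' "Y u" "D Y u" N' e Z' by (rule Z')
  obtain L where L: "linear L" "\<And>v w. G' (L v) (L w) = G v w" "L (X u) = Y u"
    "\<And>v. L (D X u v) = D Y u v" "L N = N'" "L Z = Z'"
    using frame_isometry[OF Z Z' metric[OF u]] by metis
  \<comment> \<open>By \<open>complement\<close>, pairing with \<open>Z'\<close> reads off the
    coefficient of \<open>Y u\<close>.\<close>
  define s where "s v w = G' (D2 Y u v w - L (D2 X u v w)) Z'" for v w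
  have Y2: "D2 Y u v w = L (D2 X u v w) + s v w *\<^sub>R Y u" for v w
  proof -
    let ?d = "D2 Y u v w - L (D2 X u v w)"
    have 1: "G' ?d (Y u) = 0"
      using D2_X_eq[OF u, of v w] L(2)[of "D2 X u v w" "X u"] by (simp add: GG L(3))
    have 2: "G' ?d (D Y u z) = 0" for z
      using christoffel[OF u, of v w z] L(2)[of "D2 X u v w" "D X u z"] by (simp add: GG L(4))
    have 3: "G' ?d N' = 0"
      using h[of v w] L(2)[of "D2 X u v w" N] by (simp add: GG L(5))
    show ?thesis using F'.complement[OF 1 2] 3 by (simp add: s_def algebra_simps)
  qed
  have s_sym: "sym_form s"
  proof (rule sym_formI)
    note lin = linear_D2[OF X.U X.X u] linear_D2[OF Y.U Y.X u]
    show "s v w = s w v" for v w by (simp add: s_def X.sym(1)[OF u, of v w] Y.sym(1)[OF u, of v w])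
    show "s (x + y) z = s x z + s y z" for x y z
      by (simp add: s_def linear_add[OF lin(2)] linear_add[OF lin(4)] linear_add[OF L(1)] GG)
    show "s (c *\<^sub>R x) z = c * s x z" for c x z
      by (simp add: s_def linear_scale[OF lin(2)] linear_scale[OF lin(4)] linear_scale[OF L(1)] GG algebra_simps)
  qed
  \<comment> \<open>The terms quadratic in \<open>s\<close> drop out because \<open>Y u\<close> is
    isotropic, and \<open>D2_X\<close> turns the cross terms into the metric; so
    \<open>gauss\<close> leaves a linear condition on \<open>s\<close>.\<close>
  have pair: "G' (D2 Y u v w) (D2 Y u x y) = G (D2 X u v w) (D2 X u x y)
      - s x y * G (D X u v) (D X u w) - s v w * G (D X u x) (D X u y)" for v w x y
    using L(2)[of "D2 X u v w" "X u"] L(2)[of "X u" "D2 X u x y"] L(2)[of "X u" "X u"]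
      X.D2_X[OF u, of v w] X.D2_X[OF u, of x y] sym_form_commute[OF X.G(1), of "X u" "D2 X u x y"]
      X.null[OF u]
    unfolding Y2 by (simp add: GG L(2) L(3) algebra_simps)
  have "s v w = 0" for v w
  proof (rule kulkarni_nomizu_injective[OF X.metric_sym_form[OF u] X.nd[OF u] X.dim(2) s_sym])
    show "s v z * G (D X u w) (D X u t) + s w t * G (D X u v) (D X u z) =
        s v t * G (D X u w) (D X u z) + s w z * G (D X u v) (D X u t)" for v z w t
      using gauss[OF u, of v z w t] pair[of v z w t] pair[of v t w z] by simp
  qed
  then show ?thesis using L Y2 by (intro that[of L]) (simp add: jet_isometry_def)
qed

text \<open>Frees the conclusion from \<open>L\<close>: an equality of smooth pairings on all of
  \<open>U\<close> can be differentiated, an isometry chosen at each point cannot.\<close>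

lemma D2_pairing:
  assumes "u \<in> U"
  shows "G (D2 X u v w) (D2 X u x y) = G' (D2 Y u v w) (D2 Y u x y)"
proof -
  obtain L where "jet_isometry u L" using jet_isometry_exists[OF assms] .
  then have L: "G' (L a) (L b) = G a b" "L (D2 X u c d) = D2 Y u c d" for a b c d
    by (auto simp: jet_isometry_def)
  show ?thesis using L(1)[of "D2 X u v w" "D2 X u x y"] by (simp add: L(2))
qed

text \<open>The defect \<open>D\<^sup>3Y - L D\<^sup>3X\<close> is \<open>\<delta> Y + \<nu> N'\<close> with \<open>\<nu> = a \<otimes> g\<close>; its total symmetry forces \<open>a = 0\<close>.\<close>

lemma jet_isometry_D3:
  assumes u: "u \<in> U" and iso: "jet_isometry u L"
  shows "L (D3 X u v w z) = D3 Y u v w z"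
proof -
  note GG = X.simps Y.simps
  have dim': "DIM(real^'m) = DIM('a) + 3" using X.dim by simp
  have L: "linear L" "\<And>a b. G' (L a) (L b) = G a b" "L (X u) = Y u" "\<And>v. L (D X u v) = D Y u v"
    "\<And>v w. L (D2 X u v w) = D2 Y u v w"
    using iso by (auto simp: jet_isometry_def)
  obtain N e where tf: "tangent_frame G (X u) (D X u) N e" and nu: "X.nonumbilic u N"
    using normals[OF u] by blast
  have tf': "tangent_frame G' (Y u) (D Y u) (L N) e"
    using tangent_frame_isometry[OF tf L(1,2)] Y.nonzero[OF u] by (simp add: L(3,4))
  obtain Z' where "full_frame G' (Y u) (D Y u) (L N) e Z'" using full_frame_exists[OF Y.G dim' tf'] .
  then interpret F': full_frame G' "Y u" "D Y u" "L N" e Z' .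
  define d where "d v w z = D3 Y u v w z - L (D3 X u v w z)" for v w z
  have d_sym: "d v w z = d w v z" "d v w z = d v z w" for v w z
    using X.sym(2,3)[OF u, of v w z] Y.sym(2,3)[OF u, of v w z] by (simp_all add: d_def)
  have dX: "G' (d v w z) (Y u) = 0" for v w z
    using differentiate_pairing[OF X.G(1) Y.G(1) X.U u X.diff(3)[OF u] X.diff(1)[OF u] Y.diff(3)[OF u]
        Y.diff(1)[OF u] D2_X_eq, of v w z] christoffel[OF u, of v w z] L(2)[of "D3 X u v w z" "X u"]
    by (simp add: d_def GG L(3))
  have dD: "G' (d v w z) (D Y u x) = 0" for v w z x
    using christoffel_derivative[OF u, of v w x z] D2_pairing[OF u, of v w x z]
      L(2)[of "D3 X u v w z" "D X u x"]
    by (simp add: d_def GG L(4))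
  \<comment> \<open>The derivative of \<open>D2_pairing\<close>. It is the one relation that links
    the two remaining components of the defect.\<close>
  have dD2: "G' (d v w z) (D2 Y u x y) + G' (d x y z) (D2 Y u v w) = 0" for v w x y z
    using differentiate_pairing[OF X.G(1) Y.G(1) X.U u X.diff(3)[OF u] X.diff(3)[OF u] Y.diff(3)[OF u]
        Y.diff(3)[OF u] D2_pairing, of v w x y z] L(2)[of "D3 X u v w z" "D2 X u x y"]
      L(2)[of "D3 X u x y z" "D2 X u v w"]
      sym_form_commute[OF X.G(1), of "D2 X u v w"] sym_form_commute[OF Y.G(1), of "D2 Y u v w"]
    by (simp add: d_def GG L(5))
  \<comment> \<open>For fixed \<open>z\<close> the components are functions of one index, the pair
    of the first two arguments; \<open>symmetrized_product_eq\<close> is applied to functions of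
    such pairs.\<close>
  define \<delta> where "\<delta> z p = G' (d (fst p) (snd p) z) Z'" for z p
  define \<nu> where "\<nu> z p = G' (d (fst p) (snd p) z) (L N) / e" for z p
  define g where "g p = G (D X u (fst p)) (D X u (snd p))" for p
  define h where "h p = G (D2 X u (fst p) (snd p)) N" for p
  have d: "d v w z = \<delta> z (v, w) *\<^sub>R Y u + \<nu> z (v, w) *\<^sub>R L N" for v w z
    using F'.complement[OF dX dD, of v w z] by (simp add: \<delta>_def \<nu>_def)
  have pair: "G' (d v w z) (D2 Y u x y) = \<nu> z (v, w) * h (x, y) - \<delta> z (v, w) * g (x, y)" for v w x y z
    using L(2)[of "X u" "D2 X u x y"] L(2)[of N "D2 X u x y"] X.D2_X[OF u, of x y]
      sym_form_commute[OF X.G(1), of "D2 X u x y"]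
    unfolding d by (simp add: GG L(3,5) g_def h_def)
  have eq: "\<nu> z p * h q + \<nu> z q * h p = \<delta> z p * g q + \<delta> z q * g p" for z p q
    using dD2[of "fst p" "snd p" z "fst q" "snd q"] by (simp add: pair)
  obtain b where b: "G (D X u b) (D X u b) \<noteq> 0"
    using nondegenerate_nonnull[OF X.metric_sym_form[OF u] X.nd[OF u]] .
  have indep: "\<nexists>\<kappa>. \<forall>p. h p = \<kappa> * g p"
    using nu unfolding X.nonumbilic_def by (simp add: h_def g_def split_paired_all)
  have "\<exists>a. (\<forall>p. \<nu> z p = a * g p) \<and> (\<forall>p. \<delta> z p = a * h p)" for z
  proof -
    have gb: "g (b, b) \<noteq> 0" using b by (simp add: g_def)
    show ?thesis
      by (rule symmetrized_product_eq[where \<nu> = "\<nu> z" and \<delta> = "\<delta> z", OF eq gb indep]) (intro exI conjI allI)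
  qed
  then obtain a where a: "\<And>z p. \<nu> z p = a z * g p" "\<And>z p. \<delta> z p = a z * h p" by metis
  have cyc: "a z *\<^sub>R v = a v *\<^sub>R z" for v z
  proof -
    have "d v w z = d z w v" for w by (metis d_sym)
    then have "a z * g (v, w) = a v * g (z, w)" for w
      using a(1) by (metis \<nu>_def fst_conv snd_conv)
    then have "G (D X u (a z *\<^sub>R v - a v *\<^sub>R z)) (D X u w) = 0" for w
      by (simp add: g_def GG linear_diff[OF X.linX[OF u]] linear_scale[OF X.linX[OF u]])
    then have "a z *\<^sub>R v - a v *\<^sub>R z = 0" using X.nd[OF u] unfolding nondegenerate_def by blast
    then show ?thesis by simp
  qed
  \<comment> \<open>By \<open>cyc\<close>, a nonzero \<open>a z\<close> would make every vector a
    multiple of \<open>z\<close>.\<close>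
  have "a z = 0" for z
  proof (rule ccontr)
    assume az: "a z \<noteq> 0"
    have "v \<in> span {z}" for v
    proof -
      have "v = (a v / a z) *\<^sub>R z"
        using arg_cong[OF cyc[of z v], of "\<lambda>x. (1 / a z) *\<^sub>R x"] az by simp
      then show ?thesis by (metis span_base span_scale singletonI)
    qed
    then have "span {z} = UNIV" by blast
    then have "dim {z} = DIM('a)" using dim_eq_full by blast
    then show False using X.dim(2) dim_le_card'[of "{z}"] by simp
  qed
  then have "d v w z = 0" by (simp add: d a)
  then show ?thesis by (simp add: d_def)
qed

theorem congruence:
  assumes conv: "convex U" and u1: "u1 \<in> U"
  obtains L where "linear L" "\<And>a b. G' (L a) (L b) = G a b" "\<And>u. u \<in> U \<Longrightarrow> Y u = L (X u)"
proof -
  have "\<forall>u\<in>U. \<exists>L. jet_isometry u L" using jet_isometry_exists by blast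
  then obtain L where "\<And>u. u \<in> U \<Longrightarrow> jet_isometry u (L u)" by metis
  note L = this this[unfolded jet_isometry_def]
  \<comment> \<open>The derivatives of the 2-jet are the 3-jet, so \<open>jet_isometry_D3\<close>
    supplies what the top order needs.\<close>
  define FF where "FF = insert (X, Y) ({(\<lambda>x. D X x v, \<lambda>x. D Y x v) |v. True} \<union>
    {(\<lambda>x. D2 X x v w, \<lambda>x. D2 Y x v w) |v w. True})"
  have stat: "((\<lambda>u. L u a) has_derivative (\<lambda>_. 0)) (at u)" if u: "u \<in> U" for u a
  proof (rule moving_frame_map_stationary[OF X.U u])
    show "linear (L u)" if "u \<in> U" for u using L(2)[OF that] by blast
    fix F F' assume F: "(F, F') \<in> FF"
    show "F differentiable (at u)" "F' differentiable (at u)"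
      using F X.diff[OF u] Y.diff[OF u] by (auto simp: FF_def)
    show "L u (F u) = F' u" if "u \<in> U" for u
      using F L(2)[OF that] by (auto simp: FF_def)
    show "L u (D F u v) = D F' u v" for v
      using F L(2)[OF u] jet_isometry_D3[OF u L(1)[OF u]] by (auto simp: FF_def)
  next
    obtain N e where tf: "tangent_frame G (X u) (D X u) N e" "X.nonumbilic u N"
      using normals[OF u] by blast
    have "insert (X u) (range (D X u) \<union> {D2 X u v w |v w. True}) \<subseteq> {F u |F F'. (F, F') \<in> FF}"
    proof -
      have "(X, Y) \<in> FF" "((\<lambda>x. D X x v), (\<lambda>x. D Y x v)) \<in> FF"
        "((\<lambda>x. D2 X x v w), (\<lambda>x. D2 Y x v w)) \<in> FF" for v w
        unfolding FF_def by blast+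
      then show ?thesis by fast
    qed
    from span_mono[OF this] show "span {F u |F F'. (F, F') \<in> FF} = UNIV"
      unfolding X.jet_span[OF u tf] by (rule top.extremum_uniqueI)
  qed
  have "L u a = L u1 a" if "u \<in> U" for u a
  proof -
    have "\<exists>c. \<forall>x\<in>U. L x a = c"
      using stat by (intro has_derivative_zero_constant[OF conv]) (auto intro: has_derivative_at_withinI)
    then show ?thesis using that u1 by metis
  qed
  then show ?thesis using L(2) u1 by (intro that[of "L u1"]) metis+
qed

end

section \<open>Existence and normalization of normals\<close>

context null_lift
begin

lemma restrict: "open W \<Longrightarrow> W \<subseteq> U \<Longrightarrow> null_lift G W X"
  using G U Ck_on_subset[OF X] null nonzero dim nd by unfold_locales auto

text \<open>A vector orthogonal to \<open>X\<close>, to the \<open>DX\<close> and to a transversal \<open>Z\<close> is not null, since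
  otherwise it would be orthogonal to everything.\<close>

lemma normal_exists:
  assumes u: "u \<in> U"
  obtains N where "G N N \<noteq> 0" "G N (X u) = 0" "\<And>v. G N (D X u v) = 0"
proof -
  let ?P = "D X u"
  note lin = linX[OF u]
  have DX: "G (X u) (?P v) = 0" "G (?P v) (X u) = 0" for v
    using X_perp_D[OF u] sym_form_commute[OF G(1)] by metis+
  obtain Z0 where Z0: "G (X u) Z0 \<noteq> 0"
    using G(2) nonzero[OF u] unfolding nondegenerate_def by blast
  have "linear (\<lambda>v. G Z0 (?P v))"
    by (rule linearI) (auto simp: simps linear_add[OF lin] linear_scale[OF lin])
  then obtain b where b: "\<And>w. G (?P b) (?P w) = G Z0 (?P w)"
    using sym_form_riesz[OF metric_sym_form[OF u] nd[OF u]] by blast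
  define Z where "Z = Z0 - ?P b"
  have Z: "G (X u) Z \<noteq> 0" "G Z (?P v) = 0" for v using Z0 b by (simp_all add: Z_def simps DX)
  \<comment> \<open>The target has dimension \<open>DIM('a) + 2\<close>, one less than the ambient
    space, so the kernel is nontrivial.\<close>
  define T where "T V = (G V (X u), G V Z, \<Sum>b\<in>Basis. G V (?P b) *\<^sub>R b)" for V
  have linT: "linear T"
    by (rule linearI) (auto simp: T_def simps algebra_simps scaleR_sum_right sum.distrib)
  have "\<not> inj T"
  proof
    assume "inj T"
    then have "dim (range T) = CARD('m)" using linT by (simp add: dim_image_eq)
    moreover have "dim (range T) \<le> DIM('a) + 2" using dim_subset_UNIV[of "range T"] by simp
    ultimately show False using dim by simp
  qed
  then obtain V where V: "T V = 0" "V \<noteq> 0" using linear_injective_0[OF linT] by blast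
  have VX: "G V (X u) = 0" "G V Z = 0" using V by (auto simp: T_def zero_prod_def)
  have Vb: "G V (?P b) = 0" if "b \<in> Basis" for b
  proof -
    have "inner (\<Sum>b\<in>Basis. G V (?P b) *\<^sub>R b) b = 0" using V by (simp add: T_def zero_prod_def)
    then show ?thesis using that by simp
  qed
  have VP: "G V (?P v) = 0" for v
  proof -
    have "G V (?P v) = (\<Sum>b\<in>Basis. inner v b * G V (?P b))"
      by (subst euclidean_representation[of v, symmetric])
        (simp add: linear_sum[OF lin] linear_scale[OF lin] simps
          bounded_bilinear.sum_right[OF sym_form_bounded_bilinear[OF G(1)]])
    then show ?thesis using Vb by simp
  qed
  have "G V V \<noteq> 0"
  proof
    assume VV: "G V V = 0"
    let ?F = "frame_map (X u) ?P V Z"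
    have c: "G a V = G V a" for a using sym_form_commute[OF G(1)] .
    have linF: "linear ?F"
      by (rule linearI) (auto simp: frame_map_def linear_add[OF lin] linear_scale[OF lin] algebra_simps)
    have "p = 0" if p: "?F p = 0" for p
    proof -
      obtain a b c' d where abcd: "p = (a, b, c', d)" by (cases p)
      have z: "G (?F (a, b, c', d)) W = 0" for W using p abcd by (simp add: simps)
      have zx: "G Z (X u) \<noteq> 0" using Z(1) sym_form_commute[OF G(1)] by metis
      have d: "d = 0" using z[of "X u"] zx by (simp add: frame_map_def simps DX VX null[OF u])
      have "G (?P b) (?P v) = 0" for v
        using z[of "?P v"] d by (simp add: frame_map_def simps DX VP)
      then have b: "b = 0" using nd[OF u] unfolding nondegenerate_def by blast
      then have Pb: "?P b = 0" by (simp add: linear_0[OF lin])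
      have a: "a = 0" using z[of Z] Z(1) d Pb by (simp add: frame_map_def simps VX)
      have "c' = 0" using p V(2) a d Pb by (simp add: abcd frame_map_def)
      with a b d show "p = 0" by (simp add: abcd zero_prod_def)
    qed
    then have "inj ?F" using linear_injective_0[OF linF] by blast
    then have "surj ?F" using dim by (intro linear_injective_imp_surjective[OF linF]) auto
    have "G V W = 0" for W
    proof -
      obtain p where "W = ?F p" using \<open>surj ?F\<close> by (rule surjE)
      then show ?thesis by (cases p) (simp add: frame_map_def simps VX VP VV)
    qed
    then show False using G(2) V(2) unfolding nondegenerate_def by blast
  qed
  then show ?thesis using VX(1) VP by (rule that)
qed

end

text \<open>A nonnull normal can be scaled to square 1 or -1, so either the form or its negative
  admits a normalized tangent hypersphere. The sign \<open>e\<close> records which, and is the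
  square of the normal in the original form.\<close>

lemma adapted_normal:
  fixes X :: "real^'k::finite \<Rightarrow> real^'m::finite"
  assumes "null_lift G U X" and u: "u \<in> U"
  obtains e where "e = 1 \<or> e = - 1" "adapted_form G X u = (\<lambda>x y. e * G x y)"
    "tangent_frame G (X u) (D X u) (normal_vector G X u) e"
proof -
  interpret null_lift G U X by fact
  obtain N0 where N0: "G N0 N0 \<noteq> 0" "G N0 (X u) = 0" "\<And>v. G N0 (D X u v) = 0"
    using normal_exists[OF u] by metis
  define N where "N = (1 / sqrt \<bar>G N0 N0\<bar>) *\<^sub>R N0"
  have N: "G N (X u) = 0" "G N (D X u v) = 0" for v using N0 by (simp_all add: N_def simps)
  have "G N N = sgn (G N0 N0)"
    using N0(1) by (simp add: N_def simps sgn_if abs_if real_sqrt_mult_self divide_simps flip: real_sqrt_mult)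
  then have NN: "G N N = 1 \<or> G N N = - 1" using N0(1) by (auto simp: sgn_if)
  define e :: real where "e = (if \<exists>N. tangent_hypersphere G X u N then 1 else - 1)"
  have e: "e = 1 \<or> e = - 1" by (simp add: e_def)
  have af: "adapted_form G X u = (\<lambda>x y. e * G x y)"
    by (auto simp: adapted_form_def e_def fun_eq_iff)
  have "\<exists>N. tangent_hypersphere (\<lambda>x y. e * G x y) X u N"
  proof (cases "\<exists>N. tangent_hypersphere G X u N")
    case True
    then show ?thesis by (simp add: e_def)
  next
    case False
    then have "G N N = - 1" using NN N unfolding tangent_hypersphere_def by blast
    then show ?thesis using False N by (auto simp: e_def tangent_hypersphere_def)
  qed
  then have th: "tangent_hypersphere (\<lambda>x y. e * G x y) X u (normal_vector G X u)"
    unfolding normal_vector_def af by (rule someI_ex)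
  then have "tangent_frame G (X u) (D X u) (normal_vector G X u) e"
    using e by (intro tangent_frameI[OF u]) (auto simp: tangent_hypersphere_def)
  with e af show ?thesis by (rule that)
qed

section \<open>Charts\<close>

lemma pt_scaleR: "X \<noteq> 0 \<Longrightarrow> c \<noteq> 0 \<Longrightarrow> pt (c *\<^sub>R X) = pt X"
  using pt_eq_iff[of X "c *\<^sub>R X"] by force

lemma pt_surj: obtains X where "X \<noteq> 0" "x = pt X"
proof -
  have "subspace (line_of x)" "dim (line_of x) = 1" using line_of[of x] by auto
  then obtain X where X: "X \<in> line_of x" "X \<noteq> 0"
    using dim_eq_0[of "line_of x"] by auto
  have "span {X} = line_of x"
  proof (rule subspace_dim_equal)
    show "dim (span {X}) \<ge> dim (line_of x)" using X \<open>dim (line_of x) = 1\<close> by (simp add: dim_insert)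
  qed (use X \<open>subspace (line_of x)\<close> in \<open>auto simp: span_minimal\<close>)
  then have "pt X = x" by (simp add: pt_def line_of_inverse)
  then show ?thesis using X that by blast
qed

lemma quadric_iff: "X \<noteq> 0 \<Longrightarrow> bilinear B \<Longrightarrow> pt X \<in> quadric B \<longleftrightarrow> B X X = 0"
proof
  assume X: "X \<noteq> 0" and B: "bilinear B" and "pt X \<in> quadric B"
  then obtain Y where Y: "Y \<noteq> 0" "B Y Y = 0" "pt X = pt Y" unfolding quadric_def by blast
  then obtain c where "X = c *\<^sub>R Y" using X pt_eq_iff by metis
  then show "B X X = 0" using Y(2) B by (simp add: bilinear_lmul bilinear_rmul)
qed (auto simp: quadric_def)

abbreviation chart :: "(real^'k \<Rightarrow> real^'m::finite) \<Rightarrow> real^'k::finite \<Rightarrow> 'm projective" where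
  "chart A \<equiv> \<lambda>u. pt (A u)"

lemma local_liftsD:
  assumes "(U, A) \<in> local_lifts V"
  shows "open U" "smooth_on U A" "\<And>u. u \<in> U \<Longrightarrow> A u \<noteq> 0"
    "\<And>u v. u \<in> U \<Longrightarrow> D A u v \<in> span {A u} \<Longrightarrow> v = 0"
    "openin (top_of_set V) (chart A ` U)" "\<exists>c. homeomorphism U (chart A ` U) (chart A) c"
    "continuous_on U (chart A)" "inj_on (chart A) U" "chart A ` U \<subseteq> V"
proof -
  show *: "open U" "smooth_on U A" "\<And>u. u \<in> U \<Longrightarrow> A u \<noteq> 0"
    "\<And>u v. u \<in> U \<Longrightarrow> D A u v \<in> span {A u} \<Longrightarrow> v = 0"
    "openin (top_of_set V) (chart A ` U)" "\<exists>c. homeomorphism U (chart A ` U) (chart A) c"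
    using assms unfolding local_lifts_def by auto
  then obtain c where c: "homeomorphism U (chart A ` U) (chart A) c" by blast
  show "continuous_on U (chart A)" using c by (rule homeomorphism_cont1)
  show "inj_on (chart A) U" using homeomorphism_apply1[OF c] by (rule inj_on_inverseI)
  show "chart A ` U \<subseteq> V" using *(5) openin_imp_subset by blast
qed

lemma smooth_onD:
  assumes "smooth_on U F"
  shows "Ck_on k F U" "u \<in> U \<Longrightarrow> F differentiable (at u)" "Ck_on k (\<lambda>u. D F u v) U"
    "continuous_on U F"
proof -
  show k: "Ck_on k F U" for k using assms by (simp add: smooth_on_def)
  show "u \<in> U \<Longrightarrow> F differentiable (at u)" "Ck_on k (\<lambda>u. D F u v) U" using k[of "Suc k"] by simp_all
  show "continuous_on U F" using k[of 0] by simp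
qed

lemma local_lifts_restrict:
  assumes A: "(U, A) \<in> local_lifts V" and W: "open W" "W \<subseteq> U"
  shows "(W, A) \<in> local_lifts V"
proof -
  note LL = local_liftsD[OF A]
  obtain c where c: "homeomorphism U (chart A ` U) (chart A) c" using LL(6) by blast
  have "openin (top_of_set U) W" using W LL(1) by (simp add: openin_open_eq)
  from homeomorphism_imp_open_map[OF c this] have "openin (top_of_set V) (chart A ` W)"
    using LL(5) openin_trans by blast
  moreover have "homeomorphism W (chart A ` W) (chart A) c"
    using homeomorphism_of_subsets[OF c W(2), of "chart A ` W"] W(2) by blast
  ultimately show ?thesis
    using LL W smooth_on_subset[OF LL(2) W(2)] unfolding local_lifts_def by blast
qed

text \<open>The differential changes by a factor and by a multiple of \<open>A\<close>, and the
  immersion condition is taken modulo \<open>A\<close>.\<close>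

lemma local_lifts_rescale:
  fixes \<rho> :: "real^'k::finite \<Rightarrow> real"
  assumes A: "(U, A) \<in> local_lifts V" and \<rho>: "smooth_on U \<rho>" "\<And>u. u \<in> U \<Longrightarrow> \<rho> u \<noteq> 0"
  shows "(U, \<lambda>u. \<rho> u *\<^sub>R A u) \<in> local_lifts V"
    "\<And>u v. u \<in> U \<Longrightarrow> D (\<lambda>u. \<rho> u *\<^sub>R A u) u v = \<rho> u *\<^sub>R D A u v + D \<rho> u v *\<^sub>R A u"
proof -
  note LL = local_liftsD[OF A]
  let ?A = "\<lambda>u. \<rho> u *\<^sub>R A u"
  show DA: "D ?A u v = \<rho> u *\<^sub>R D A u v + D \<rho> u v *\<^sub>R A u" if "u \<in> U" for u v
    using D_eqI[OF has_derivative_scaleR[OF has_derivative_D[OF smooth_onD(2)[OF \<rho>(1) that]]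
          has_derivative_D[OF smooth_onD(2)[OF LL(2) that]]]] by simp
  have pt: "chart ?A u = chart A u" if "u \<in> U" for u
    using pt_scaleR[OF LL(3)[OF that] \<rho>(2)[OF that]] .
  then have im: "chart ?A ` U = chart A ` U" by (rule image_cong[OF refl])
  obtain c where c: "homeomorphism U (chart A ` U) (chart A) c" using LL(6) by blast
  have "homeomorphism U (chart A ` U) (chart ?A) c"
    by (rule homeomorphism_cong[OF c]) (use pt in auto)
  moreover have "v = 0" if u: "u \<in> U" and v: "D ?A u v \<in> span {?A u}" for u v
  proof -
    obtain k where "\<rho> u *\<^sub>R D A u v + D \<rho> u v *\<^sub>R A u = k *\<^sub>R (\<rho> u *\<^sub>R A u)"
      using v unfolding DA[OF u] span_singleton by blast
    then have "\<rho> u *\<^sub>R D A u v = (k * \<rho> u - D \<rho> u v) *\<^sub>R A u" by (simp add: algebra_simps)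
    then have "(1 / \<rho> u) *\<^sub>R (\<rho> u *\<^sub>R D A u v) = (1 / \<rho> u) *\<^sub>R ((k * \<rho> u - D \<rho> u v) *\<^sub>R A u)" by simp
    then have "D A u v = ((k * \<rho> u - D \<rho> u v) / \<rho> u) *\<^sub>R A u" using \<rho>(2)[OF u] by simp
    then have "D A u v \<in> span {A u}" by (simp add: span_base span_scale)
    then show ?thesis by (rule LL(4)[OF u])
  qed
  moreover have "smooth_on U ?A"
    using \<rho>(1) LL(1,2) Ck_on_bilinear[OF bounded_bilinear_scaleR] unfolding smooth_on_def by blast
  ultimately show "(U, ?A) \<in> local_lifts V"
    using LL \<rho>(2) im unfolding local_lifts_def by auto
qed

text \<open>Invariance of domain makes the injective \<open>\<tau>\<close> a homeomorphism onto an
  open set.\<close>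

lemma local_lifts_reparametrize:
  fixes \<tau> :: "real^'k::finite \<Rightarrow> real^'k"
  assumes A: "(U, A) \<in> local_lifts V" and W: "open W" "\<tau> ` W \<subseteq> U"
    and \<tau>: "smooth_on W \<tau>" "inj_on \<tau> W" "\<And>u. u \<in> W \<Longrightarrow> bij (D \<tau> u)"
  shows "(W, \<lambda>u. A (\<tau> u)) \<in> local_lifts V"
proof -
  note LL = local_liftsD[OF A]
  let ?A = "\<lambda>u. A (\<tau> u)"
  have cont: "continuous_on W \<tau>" using \<tau>(1) by (rule smooth_onD(4))
  have open_im: "open (\<tau> ` W)" using invariance_of_domain[OF cont W(1) \<tau>(2)] .
  obtain d where d: "homeomorphism W (\<tau> ` W) \<tau> d"
    using invariance_of_domain_homeomorphism[OF W(1) cont _ \<tau>(2)] by blast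
  note LL' = local_liftsD[OF local_lifts_restrict[OF A open_im W(2)]]
  obtain c where "homeomorphism (\<tau> ` W) (chart A ` \<tau> ` W) (chart A) c" using LL'(6) by blast
  from homeomorphism_compose[OF d this]
  have "\<exists>c. homeomorphism W (chart ?A ` W) (chart ?A) c"
    by (auto simp: o_def image_image)
  moreover have "openin (top_of_set V) (chart ?A ` W)" using LL'(5) by (simp add: image_image)
  moreover have "smooth_on W ?A"
    using Ck_on_compose[OF W] LL(2) \<tau>(1) unfolding smooth_on_def by blast
  moreover have "v = 0" if u: "u \<in> W" and v: "D ?A u v \<in> span {?A u}" for u v
  proof -
    have "D ?A u = (\<lambda>v. D A (\<tau> u) (D \<tau> u v))"
      using u W(2) by (intro D_eqI has_derivative_compose[OF has_derivative_D has_derivative_D]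
          smooth_onD(2)[OF \<tau>(1)] smooth_onD(2)[OF LL(2)]) auto
    then have "D \<tau> u v = 0" using v LL(4)[of "\<tau> u" "D \<tau> u v"] u W(2) by auto
    moreover have "linear (D \<tau> u)" using smooth_onD(2)[OF \<tau>(1) u] by (rule linear_D)
    ultimately show "v = 0" using \<tau>(3)[OF u] linear_injective_0 unfolding bij_def by blast
  qed
  ultimately show ?thesis using W LL(3) unfolding local_lifts_def by auto
qed

text \<open>The vectors \<open>e i\<close> are not assumed to be a basis. Pairing a combination with
  \<open>e j\<close> recovers its coefficient up to sign, so they are independent, and by their
  number they span.\<close>

lemma signature_sym_form:
  fixes B :: "'m::finite form"
  assumes "symmetric_form_of_signature B r s"
  shows "sym_form B" "nondegenerate B"
proof -
  show B: "sym_form B" using assms by (simp add: symmetric_form_of_signature_def sym_form_def)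
  obtain e :: "'m \<Rightarrow> real^'m" where e0: "\<forall>i j. i \<noteq> j \<longrightarrow> B (e i) (e j) = 0"
    "\<forall>i. B (e i) (e i) = 1 \<or> B (e i) (e i) = - 1"
    using assms unfolding symmetric_form_of_signature_def by (elim conjE exE)
  have e: "i \<noteq> j \<Longrightarrow> B (e i) (e j) = 0" "B (e i) (e i) \<noteq> 0" for i j
    using e0(1) spec[OF e0(2), of i] by auto
  define T where "T x = (\<Sum>i\<in>UNIV. (x $ i) *\<^sub>R e i)" for x :: "real^'m"
  have lin: "linear T"
    by (rule linearI) (auto simp: T_def scaleR_add_left sum.distrib scaleR_sum_right)
  have BT: "B (T x) (e j) = x $ j * B (e j) (e j)" for x j
  proof -
    have "B (T x) (e j) = (\<Sum>i\<in>UNIV. x $ i * B (e i) (e j))"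
      by (simp add: T_def bounded_bilinear.sum_left[OF sym_form_bounded_bilinear[OF B]] sym_form_simps[OF B])
    also have "\<dots> = (\<Sum>i\<in>UNIV. if i = j then x $ j * B (e j) (e j) else 0)"
      by (rule sum.cong) (auto simp: e)
    finally show ?thesis by simp
  qed
  have "x = 0" if "T x = 0" for x
    using BT[of x] e(2) that by (simp add: sym_form_simps[OF B] vec_eq_iff)
  then have "inj T" using linear_injective_0[OF lin] by blast
  then have "surj T" by (rule linear_injective_imp_surjective[OF lin _ refl])
  show "nondegenerate B"
    unfolding nondegenerate_def
  proof (intro allI impI)
    fix v assume v: "\<forall>w. B v w = 0"
    obtain x where x: "v = T x" using \<open>surj T\<close> by (rule surjE)
    have "x $ j = 0" for j using BT[of x j] e(2)[of j] v x by simp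
    then have "x = 0" by (simp add: vec_eq_iff)
    then show "v = 0" by (simp add: x linear_0[OF lin])
  qed
qed

section \<open>From the conformal element to congruent lifts\<close>

lemma local_lifts_null_lift:
  fixes A :: "real^'k::finite \<Rightarrow> real^'m::finite"
  assumes B: "sym_form B" "nondegenerate B" and V: "V \<subseteq> quadric B"
    and iso: "nonisotropic TYPE('k) B V" and dim: "CARD('m) = CARD('k) + 3" "CARD('k) \<ge> 3"
    and A: "(U, A) \<in> local_lifts V"
  shows "null_lift B U A"
proof
  note LL = local_liftsD[OF A]
  show "Ck_on 3 A U" using LL(2) by (rule smooth_onD(1))
  show "B (A u) (A u) = 0" if "u \<in> U" for u
    using LL(9) V that quadric_iff[OF LL(3)[OF that], of B] B(1) by (auto simp: sym_form_def)
  show "nondegenerate (\<lambda>v w. B (D A u v) (D A u w))" if "u \<in> U" for u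
    using iso A that unfolding nonisotropic_def nondegenerate_def first_form_def by blast
qed (use B dim local_liftsD[OF A] in auto)

text \<open>Rewrites the pointwise conclusion about the adapted forms in terms of \<open>B\<close>.
  The signs \<open>e\<close>, \<open>e'\<close> undo the adaptation, the ambiguous sign of
  \<open>h\<close> is put into \<open>N'\<close>, and \<open>t\<close> collects both traces, a
  multiple of the metric that a shift of the normal can remove.\<close>

lemma corresponding_forms:
  fixes A Y :: "real^'k::finite \<Rightarrow> real^'m::finite"
  assumes nlA: "null_lift B W A" and nlY: "null_lift B W Y" and u: "u \<in> W"
    and umb: "\<nexists>\<kappa>. \<forall>v w. h_tilde B A u v w = \<kappa> * g_form B A u v w"
    and elem: "\<And>v. g_form B A u v v \<noteq> 0 \<Longrightarrow> g_form B Y u v v \<noteq> 0 \<Longrightarrow>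
      conformal_element B Y u v = conformal_element B A u v"
  obtains c e e' N N' t where "c > 0" "e = 1 \<or> e = - 1" "e' = 1 \<or> e' = - 1"
    "tangent_frame B (A u) (D A u) N e" "tangent_frame B (Y u) (D Y u) N' e'"
    "null_lift.nonumbilic B A u N"
    "\<And>v w. B (D Y u v) (D Y u w) = c * e * e' * B (D A u v) (D A u w)"
    "\<And>v w. B (D2 Y u v w) N' = sqrt c * e * e' * B (D2 A u v w) N + t * B (D A u v) (D A u w)"
proof -
  interpret A: null_lift B W A by fact
  interpret Y: null_lift B W Y by fact
  obtain e where e: "e = 1 \<or> e = - 1" and ae: "adapted_form B A u = (\<lambda>x y. e * B x y)"
    and tA: "tangent_frame B (A u) (D A u) (normal_vector B A u) e" using adapted_normal[OF nlA u] .
  obtain e' where e': "e' = 1 \<or> e' = - 1" and ae': "adapted_form B Y u = (\<lambda>x y. e' * B x y)"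
    and tY: "tangent_frame B (Y u) (D Y u) (normal_vector B Y u) e'" using adapted_normal[OF nlY u] .
  let ?N = "normal_vector B A u" and ?N' = "normal_vector B Y u"
  have h_sym: "sym_form (\<lambda>v w. c * B (D2 F u v w) n)" if "null_lift B W F" for F c n
  proof -
    interpret F: null_lift B W F by fact
    note lin = linear_D2(2)[OF F.U F.X u]
    show ?thesis
    proof (rule sym_formI)
      show "c * B (D2 F u v w) n = c * B (D2 F u w v) n" for v w by (simp add: F.sym(1)[OF u, of v w])
    qed (simp_all add: linear_add[OF lin] linear_scale[OF lin] F.simps algebra_simps)
  qed
  define \<kappa> where "\<kappa> = mean_trace (g_form B A u) (h_tilde B A u)"
  define \<kappa>' where "\<kappa>' = mean_trace (g_form B Y u) (h_tilde B Y u)"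
  have g: "g_form B A u = (\<lambda>v w. e * B (D A u v) (D A u w))"
    "g_form B Y u = (\<lambda>v w. e' * B (D Y u v) (D Y u w))"
    by (auto simp: g_form_def first_form_def ae ae' fun_eq_iff)
  have ht: "h_tilde B A u = (\<lambda>v w. e * B (D2 A u v w) ?N)" "h_tilde B Y u = (\<lambda>v w. e' * B (D2 Y u v w) ?N')"
    by (auto simp: h_tilde_def ae ae' fun_eq_iff)
  have h: "h_form B A u = (\<lambda>v w. h_tilde B A u v w - \<kappa> * g_form B A u v w)"
    "h_form B Y u = (\<lambda>v w. h_tilde B Y u v w - \<kappa>' * g_form B Y u v w)"
    by (auto simp: h_form_def \<kappa>_def \<kappa>'_def fun_eq_iff)
  have gs: "sym_form (g_form B A u)" "sym_form (g_form B Y u)"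
    unfolding g by (intro sym_form_scale A.metric_sym_form Y.metric_sym_form u)+
  have hs: "sym_form (h_form B A u)" "sym_form (h_form B Y u)"
    unfolding h by (intro sym_form_diff sym_form_scale gs; simp add: ht h_sym nlA nlY)+
  have nd: "nondegenerate (g_form B A u)" "nondegenerate (g_form B Y u)"
    using A.nd[OF u] Y.nd[OF u] e e' unfolding nondegenerate_def g by auto
  obtain v0 w0 where h0: "h_form B A u v0 w0 \<noteq> 0"
    using umb unfolding h by (metis eq_iff_diff_eq_0)
  have dim2: "DIM(real^'k) \<ge> 2" using A.dim by simp
  obtain c \<sigma> where c: "c > 0" "\<And>v w. g_form B Y u v w = c * g_form B A u v w" "\<sigma> = 1 \<or> \<sigma> = - 1"
    "\<And>v w. h_form B Y u v w = \<sigma> * sqrt c * h_form B A u v w"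
    by (rule quadratic_element_determines_forms[OF gs hs nd dim2 h0])
      (use elem in \<open>auto simp: conformal_element_def\<close>)
  have gY: "B (D Y u v) (D Y u w) = c * e * e' * B (D A u v) (D A u w)" for v w
    using c(2)[of v w] e e' unfolding g by auto
  have "B (D2 Y u v w) (\<sigma> *\<^sub>R ?N') = sqrt c * e * e' * B (D2 A u v w) ?N
      + (e * e' * (\<sigma> * \<kappa>' * c - sqrt c * \<kappa>)) * B (D A u v) (D A u w)" for v w
  proof -
    have "e' * B (D2 Y u v w) ?N' - \<kappa>' * (c * (e * B (D A u v) (D A u w)))
      = \<sigma> * sqrt c * (e * B (D2 A u v w) ?N - \<kappa> * (e * B (D A u v) (D A u w)))"
      using c(4)[of v w] c(2)[of v w] by (simp add: h ht g)
    then have "\<sigma> * e' * (e' * B (D2 Y u v w) ?N')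
      = \<sigma> * e' * (\<kappa>' * (c * (e * B (D A u v) (D A u w)))
        + \<sigma> * sqrt c * (e * B (D2 A u v w) ?N - \<kappa> * (e * B (D A u v) (D A u w))))"
      by (simp only: diff_eq_eq) simp
    moreover have "e' * (e' * x) = x" "\<sigma> * (\<sigma> * x) = x" for x :: real using e' c(3) by auto
    ultimately show ?thesis by (simp add: A.simps algebra_simps)
  qed
  moreover have "tangent_frame B (Y u) (D Y u) (\<sigma> *\<^sub>R ?N') e'"
    using tY c(3) by (auto simp: tangent_frame_def A.simps)
  moreover have "A.nonumbilic u ?N"
    unfolding A.nonumbilic_def
  proof
    assume "\<exists>\<kappa>. \<forall>v w. B (D2 A u v w) ?N = \<kappa> * B (D A u v) (D A u w)"
    then obtain k where "\<And>v w. B (D2 A u v w) ?N = k * B (D A u v) (D A u w)" by blast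
    then have "\<forall>v w. h_tilde B A u v w = k * g_form B A u v w" by (simp add: ht g)
    with umb show False by blast
  qed
  ultimately show ?thesis using that[OF c(1) e e' tA _ _ gY] by blast
qed

text \<open>When the metrics agree up to the sign \<open>s\<close>, positivity forces
  \<open>c = 1\<close> and \<open>s = e * e'\<close>. Passing to \<open>s * B\<close> on the second
  side therefore gives both normals the same square \<open>e\<close>.\<close>

lemma congruent_lifts_of_element:
  fixes A Y :: "real^'k::finite \<Rightarrow> real^'m::finite"
  assumes nlA: "null_lift B W A" and nlY: "null_lift B W Y" and s: "s = 1 \<or> s = - 1"
    and metric: "\<And>u v w. u \<in> W \<Longrightarrow> B (D Y u v) (D Y u w) = s * B (D A u v) (D A u w)"
    and umb: "\<And>u. u \<in> W \<Longrightarrow> \<nexists>\<kappa>. \<forall>v w. h_tilde B A u v w = \<kappa> * g_form B A u v w"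
    and elem: "\<And>u v. u \<in> W \<Longrightarrow> g_form B A u v v \<noteq> 0 \<Longrightarrow> g_form B Y u v v \<noteq> 0 \<Longrightarrow>
      conformal_element B Y u v = conformal_element B A u v"
  shows "congruent_lifts B (\<lambda>x y. s * B x y) W A Y"
proof -
  interpret A: null_lift B W A by fact
  interpret Y: null_lift B W Y by fact
  interpret Y': null_lift "\<lambda>x y. s * B x y" W Y
  proof
    show "sym_form (\<lambda>x y. s * B x y)" by (rule sym_form_scale[OF Y.G(1)])
    show "nondegenerate (\<lambda>x y. s * B x y)"
      using Y.G(2) s unfolding nondegenerate_def by auto
    show "nondegenerate (\<lambda>v w. s * B (D Y u v) (D Y u w))" if "u \<in> W" for u
      using Y.nd[OF that] s unfolding nondegenerate_def by auto
  qed (use Y.U Y.X Y.null Y.nonzero Y.dim in auto)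
  show ?thesis
  proof
    show "B (D A u v) (D A u w) = s * B (D Y u v) (D Y u w)" if "u \<in> W" for u v w
      using metric[OF that] s by auto
    fix u assume u: "u \<in> W"
    obtain c e e' N N' t where c: "c > 0" "e = 1 \<or> e = - 1" "e' = 1 \<or> e' = - 1"
      and tA: "tangent_frame B (A u) (D A u) N e" and tY: "tangent_frame B (Y u) (D Y u) N' e'"
      and nu: "A.nonumbilic u N"
      and g: "\<And>v w. B (D Y u v) (D Y u w) = c * e * e' * B (D A u v) (D A u w)"
      and h: "\<And>v w. B (D2 Y u v w) N' = sqrt c * e * e' * B (D2 A u v w) N + t * B (D A u v) (D A u w)"
      by (rule corresponding_forms[OF nlA nlY u umb[OF u] elem[OF u]]) blast+
    obtain a where a: "B (D A u a) (D A u a) \<noteq> 0"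
      using nondegenerate_nonnull[OF A.metric_sym_form[OF u] A.nd[OF u]] .
    then have "s = c * e * e'" using g[of a a] metric[OF u, of a a] by simp
    then have c1: "c = 1" and se: "s = e * e'" using c s by auto
    \<comment> \<open>By \<open>D2_X\<close>, adding r Y to \<open>N'\<close> subtracts r times the
      metric of \<open>Y\<close>, that is r s times that of \<open>A\<close>; r = s t cancels the
      trace term because s has square 1.\<close>
    let ?N = "N' + (s * t) *\<^sub>R Y u"
    have "tangent_frame (\<lambda>x y. s * B x y) (Y u) (D Y u) ?N e"
    proof -
      have Y0: "B (Y u) N' = 0" "B N' (Y u) = 0" "B (Y u) (Y u) = 0" "B (Y u) (D Y u v) = 0" for v
        using tY Y.null[OF u] Y.X_perp_D[OF u] sym_form_commute[OF A.G(1), of "Y u" N']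
        by (auto simp: tangent_frame_def)
      have "s * e' = e" "e \<noteq> 0" using se c by auto
      then show ?thesis
        using tY c(2) Y'.nd[OF u] by (simp add: tangent_frame_def A.simps Y0)
    qed
    moreover have "B (D2 A u v w) N = s * B (D2 Y u v w) ?N" for v w
    proof -
      have "B (D2 Y u v w) ?N = s * B (D2 A u v w) N + t * g v w - s * t * (s * g v w)"
        if "g = (\<lambda>v w. B (D A u v) (D A u w))" for g
        using h[of v w] by (simp add: A.simps Y.D2_X[OF u] metric[OF u] that c1 se)
      then show ?thesis using s by (elim disjE) simp_all
    qed
    ultimately show "\<exists>N N' e. tangent_frame B (A u) (D A u) N e \<and>
      tangent_frame (\<lambda>x y. s * B x y) (Y u) (D Y u) N' e \<and> A.nonumbilic u N \<and>
      (\<forall>v w. B (D2 A u v w) N = s * B (D2 Y u v w) N')"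
      using tA nu by blast
  qed
qed

text \<open>\<open>L X = c X\<close> forces \<open>c\<^sup>2 = \<epsilon>\<close>, so \<open>c\<close> is constant and is also the factor of \<open>L\<close> on the 2-jets.\<close>

lemma (in null_lift) similarity_fixing_lift_is_scalar:
  assumes L: "linear L" "\<And>a b. G (L a) (L b) = \<epsilon> * G a b" and \<epsilon>: "\<epsilon> \<noteq> 0"
    and fixed: "\<And>u. u \<in> U \<Longrightarrow> \<exists>c. L (X u) = c *\<^sub>R X u"
    and u0: "u0 \<in> U" and tf: "tangent_frame G (X u0) (D X u0) N e" and nu: "nonumbilic u0 N"
  obtains c where "\<And>a. L a = c *\<^sub>R a"
proof -
  \<comment> \<open>The factor is written as a Euclidean Rayleigh quotient to make its
    differentiability visible.\<close>
  define c where "c u = inner (L (X u)) (X u) / inner (X u) (X u)" for u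
  have LX: "L (X u) = c u *\<^sub>R X u" if u: "u \<in> U" for u
    using fixed[OF u] nonzero[OF u] by (auto simp: c_def)
  have bl: "bounded_linear L" using L(1) by (simp add: linear_conv_bounded_linear)
  have dL: "((\<lambda>x. L (F x)) has_derivative (\<lambda>v. L (D F u v))) (at u)"
    if "F differentiable (at u)" for F :: "'a \<Rightarrow> real^'m" and u
    by (rule bounded_linear.has_derivative[OF bl has_derivative_D[OF that]])
  have dc: "c differentiable (at u)" if u: "u \<in> U" for u
  proof -
    have "(\<lambda>x. L (X x)) differentiable (at u)" using dL[OF diff(1)[OF u]] by (rule differentiableI)
    then show ?thesis
      unfolding c_def using diff(1)[OF u] nonzero[OF u]
      by (auto intro!: differentiable_divide differentiable_inner)
  qed
  have 1: "L (D X u v) = c u *\<^sub>R D X u v + D c u v *\<^sub>R X u" if u: "u \<in> U" for u v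
  proof -
    note * = has_derivative_transform_within_open[OF dL[OF diff(1)[OF u]] U u LX]
    show ?thesis
      using has_derivative_unique[OF * has_derivative_scaleR[OF has_derivative_D[OF dc[OF u]]
            has_derivative_D[OF diff(1)[OF u]]]] by meson
  qed
  \<comment> \<open>Pairing \<open>X u\<close> with itself gives nothing, as it is null; the first
    derivatives have nonnull values.\<close>
  have c2: "c u * c u = \<epsilon>" if u: "u \<in> U" for u
  proof -
    obtain a where a: "G (D X u a) (D X u a) \<noteq> 0"
      using nondegenerate_nonnull[OF metric_sym_form[OF u] nd[OF u]] .
    have "c u * c u * G (D X u a) (D X u a) = \<epsilon> * G (D X u a) (D X u a)"
      using L(2)[of "D X u a" "D X u a"] X_perp_D[OF u, of a] sym_form_commute[OF G(1), of "D X u a" "X u"]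
      by (simp add: 1[OF u] simps null[OF u])
    then show ?thesis using a by simp
  qed
  have Dc: "D c u v = 0" if u: "u \<in> U" for u v
  proof -
    note * = has_derivative_transform_within_open[OF has_derivative_mult[OF has_derivative_D[OF dc[OF u]]
          has_derivative_D[OF dc[OF u]]] U u c2]
    have "c u * D c u v + D c u v * c u = 0"
      using has_derivative_unique[OF * has_derivative_const] by meson
    moreover have "c u \<noteq> 0" using c2[OF u] \<epsilon> by auto
    ultimately show ?thesis by simp
  qed
  have 2: "L (D2 X u v w) = c u *\<^sub>R D2 X u v w" if u: "u \<in> U" for u v w
  proof -
    have "L (D X x v) = c x *\<^sub>R D X x v" if "x \<in> U" for x using 1[OF that] Dc[OF that] by simp
    note * = has_derivative_transform_within_open[OF dL[OF diff(2)[OF u]] U u this]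
    have "L (D2 X u v w) = c u *\<^sub>R D2 X u v w + D c u w *\<^sub>R D X u v"
      using has_derivative_unique[OF * has_derivative_scaleR[OF has_derivative_D[OF dc[OF u]]
            has_derivative_D[OF diff(2)[OF u]]]] by meson
    then show ?thesis using Dc[OF u] by simp
  qed
  have "L a = c u0 *\<^sub>R a" for a
  proof (rule linear_eq_on_span[OF L(1)])
    show "linear (\<lambda>a. c u0 *\<^sub>R a)" by (rule linear_scaleR)
    show "a \<in> span (insert (X u0) (range (D X u0) \<union> {D2 X u0 v w |v w. True}))"
      unfolding jet_span[OF u0 tf nu] by simp
  qed (use LX[OF u0] 1[OF u0] Dc[OF u0] 2[OF u0] in auto)
  then show ?thesis by (rule that)
qed

section \<open>Corresponding hypersurfaces\<close>

text \<open>Anti-isometries are included: they preserve the quadric as well. They exist only in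
  neutral signature.\<close>

definition similarity :: "'m::finite form \<Rightarrow> (real^'m \<Rightarrow> real^'m) \<Rightarrow> bool" where
  "similarity B L \<longleftrightarrow> linear L \<and> (\<exists>s. (s = 1 \<or> s = - 1) \<and> (\<forall>a b. s * B (L a) (L b) = B a b))"

lemma similarity_bij:
  assumes "sym_form B" "nondegenerate B" "similarity B L" shows "bij L"
proof -
  obtain s where L: "linear L" "\<And>a b. s * B (L a) (L b) = B a b" using assms(3) by (auto simp: similarity_def)
  have "a = 0" if "L a = 0" for a
  proof -
    have "B a b = 0" for b using L(2)[of a b] that by (simp add: sym_form_simps[OF assms(1)])
    then show ?thesis using assms(2) by (auto simp: nondegenerate_def)
  qed
  then have "inj L" using linear_injective_0[OF L(1)] by blast
  moreover from this have "surj L" by (rule linear_injective_imp_surjective[OF L(1) _ refl])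
  ultimately show ?thesis by (simp add: bij_def)
qed

lemma similarity_conformal:
  assumes B: "sym_form B" "nondegenerate B" and L: "similarity B L"
  obtains \<phi> where "conformal_transformation B \<phi>" "\<And>X. X \<noteq> 0 \<Longrightarrow> \<phi> (pt X) = pt (L X)"
proof -
  define \<phi> where "\<phi> x = Abs_projective (L ` line_of x)" for x
  have lin: "linear L" using L by (simp add: similarity_def)
  have bij: "bij L" by (rule similarity_bij[OF B L])
  obtain s where s: "s = 1 \<or> s = - 1" "\<And>a b. s * B (L a) (L b) = B a b" using L by (auto simp: similarity_def)
  have L0: "L X \<noteq> 0" if "X \<noteq> 0" for X
    using that bij linear_injective_0[OF lin] unfolding bij_def by blast
  have \<phi>: "\<phi> (pt X) = pt (L X)" if "X \<noteq> 0" for X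
    using linear_span_image[OF lin, of "{X}"] unfolding \<phi>_def line_of_pt[OF that]
    by (simp add: pt_def)
  have null: "B (L X) (L X) = 0 \<longleftrightarrow> B X X = 0" for X using s(2)[of X X] s(1) by auto
  have "\<phi> ` quadric B = quadric B"
  proof
    show "\<phi> ` quadric B \<subseteq> quadric B"
      using \<phi> L0 null by (auto simp: quadric_def)
    show "quadric B \<subseteq> \<phi> ` quadric B"
    proof
      fix x assume "x \<in> quadric B"
      then obtain Y where Y: "Y \<noteq> 0" "B Y Y = 0" "x = pt Y" by (auto simp: quadric_def)
      obtain X where X: "Y = L X" using bij by (metis bij_pointE)
      then have "X \<noteq> 0" using Y(1) linear_0[OF lin] by auto
      moreover from this have "pt X \<in> quadric B" using Y(2) null X by (auto simp: quadric_def)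
      ultimately show "x \<in> \<phi> ` quadric B" using \<phi> Y(3) X by (metis imageI)
    qed
  qed
  then have "conformal_transformation B \<phi>"
    using lin bij \<phi> unfolding conformal_transformation_def projective_transformation_def by blast
  then show ?thesis using \<phi> by (rule that)
qed

section \<open>Common coordinates on corresponding hypersurfaces\<close>

locale hypersurface_correspondence =
  fixes B :: "'m::finite form" and V V' :: "'m projective set" and Or Or' :: "('k::finite, 'm) lift set"
    and f :: "'m projective \<Rightarrow> 'm projective"
  assumes B: "sym_form B" "nondegenerate B"
    and dim: "CARD('m) = CARD('k) + 3" "CARD('k) \<ge> 3"
    and or: "oriented_hypersurface B V Or" "oriented_hypersurface B V' Or'"
    and iso: "nonisotropic TYPE('k) B V" "nonisotropic TYPE('k) B V'"
    and umb: "\<forall>x\<in>V. \<not> umbilical_point TYPE('k) B V x"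
    and corr: "smooth_correspondence TYPE('k) V V' f"
    and elem: "preserves_conformal_element TYPE('k) B V V' f"
begin

lemma chart_at:
  assumes "x \<in> V" obtains U A u where "(U, A :: real^'k \<Rightarrow> real^'m) \<in> local_lifts V" "u \<in> U" "x = pt (A u)"
  using assms or(1) unfolding oriented_hypersurface_def by blast

lemma chart_at':
  assumes "x \<in> V'" obtains U A u where "(U, A :: real^'k \<Rightarrow> real^'m) \<in> local_lifts V'" "u \<in> U" "x = pt (A u)"
  using assms or(2) unfolding oriented_hypersurface_def by blast

lemma lift_null_lift: "(U, A :: real^'k \<Rightarrow> real^'m) \<in> local_lifts V \<Longrightarrow> null_lift B U A"
  using local_lifts_null_lift[OF B _ iso(1) dim] or(1) by (simp add: oriented_hypersurface_def)

lemma lift_null_lift': "(U, A :: real^'k \<Rightarrow> real^'m) \<in> local_lifts V' \<Longrightarrow> null_lift B U A"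
  using local_lifts_null_lift[OF B _ iso(2) dim] or(2) by (simp add: oriented_hypersurface_def)

lemma not_umbilical:
  assumes A: "(U, A :: real^'k \<Rightarrow> real^'m) \<in> local_lifts V" and u: "u \<in> U"
  shows "\<nexists>\<kappa>. \<forall>v w. h_tilde B A u v w = \<kappa> * g_form B A u v w"
proof -
  have "pt (A u) \<in> V" using local_liftsD(9)[OF A] u by blast
  then show ?thesis using umb A u unfolding umbilical_point_def by fast
qed

lemma f_bij: "bij_betw f V V'" and f_cont: "continuous_on V f"
  using corr by (auto simp: smooth_correspondence_def)

text \<open>Composing a chart of \<open>V'\<close> with the coordinate expression of
  \<open>f\<close> parametrizes \<open>V'\<close> by the coordinates of \<open>V\<close>, in which
  \<open>f\<close> becomes the identity.\<close>

lemma pulled_back_lift: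
  assumes A: "(U, A :: real^'k \<Rightarrow> real^'m) \<in> local_lifts V" and u0: "u0 \<in> U"
  obtains W Y where "open W" "W \<subseteq> U" "u0 \<in> W" "(W, Y :: real^'k \<Rightarrow> real^'m) \<in> local_lifts V'"
    "\<And>u. u \<in> W \<Longrightarrow> f (pt (A u)) = pt (Y u)"
proof -
  note LL = local_liftsD[OF A]
  have fV: "f (pt (A u)) \<in> V'" if "u \<in> U" for u
    using LL(9) that bij_betwE[OF f_bij] by blast
  obtain U' A' u' where A': "(U', A' :: real^'k \<Rightarrow> real^'m) \<in> local_lifts V'" "u' \<in> U'" "f (pt (A u0)) = pt (A' u')"
    using chart_at'[OF fV[OF u0]] .
  note LL' = local_liftsD[OF A'(1)]
  define W where "W = {u\<in>U. f (pt (A u)) \<in> chart A' ` U'}"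
  define \<tau> where "\<tau> = coord_rep f A (U', A')"
  have \<tau>: "smooth_on W \<tau>" "\<And>u. u \<in> W \<Longrightarrow> bij (D \<tau> u)"
    using corr A A'(1) unfolding smooth_correspondence_def W_def \<tau>_def Let_def by fast+
  have \<tau>': "\<tau> u \<in> U'" "pt (A' (\<tau> u)) = f (pt (A u))" if "u \<in> W" for u
  proof -
    have *: "f (pt (A u)) \<in> chart A' ` U'" using that by (simp add: W_def)
    show "\<tau> u \<in> U'" using inv_into_into[OF *] by (simp add: \<tau>_def coord_rep_def)
    show "pt (A' (\<tau> u)) = f (pt (A u))" using f_inv_into_f[OF *] by (simp add: \<tau>_def coord_rep_def)
  qed
  have cont: "continuous_on U (\<lambda>u. f (pt (A u)))"
    by (rule continuous_on_compose2[OF f_cont LL(7) LL(9)])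
  obtain T where T: "open T" "chart A' ` U' = V' \<inter> T" using LL'(5) by (auto simp: openin_open)
  have "W = U \<inter> (\<lambda>u. f (pt (A u))) -` T" using fV by (auto simp: W_def T(2))
  then have oW: "open W" using continuous_open_preimage[OF cont LL(1) T(1)] by simp
  have inj: "inj_on \<tau> W"
  proof (rule inj_onI)
    fix u w assume uw: "u \<in> W" "w \<in> W" "\<tau> u = \<tau> w"
    then have "f (pt (A u)) = f (pt (A w))" using \<tau>'(2) by metis
    moreover have U: "u \<in> U" "w \<in> U" using uw by (auto simp: W_def)
    then have "pt (A u) \<in> V" "pt (A w) \<in> V" using LL(9) by blast+
    ultimately have "pt (A u) = pt (A w)" using f_bij by (meson bij_betw_imp_inj_on inj_onD)
    then show "u = w" using LL(8) U by (meson inj_onD)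
  qed
  have "(W, \<lambda>u. A' (\<tau> u)) \<in> local_lifts V'"
    using \<tau>' by (intro local_lifts_reparametrize[OF A'(1) oW _ \<tau>(1) inj \<tau>(2)]) auto
  moreover have "u0 \<in> W" using u0 A' by (auto simp: W_def)
  moreover have "W \<subseteq> U" by (auto simp: W_def)
  ultimately show ?thesis using that oW \<tau>'(2) by metis
qed

text \<open>In common coordinates the differential of \<open>f\<close> is the identity, so both
  elements are evaluated on the same \<open>v\<close>.\<close>

lemma element_of_pulled_back_lift:
  assumes A: "(W, A :: real^'k \<Rightarrow> real^'m) \<in> local_lifts V" and Y: "(W, Y :: real^'k \<Rightarrow> real^'m) \<in> local_lifts V'"
    and fA: "\<And>u. u \<in> W \<Longrightarrow> f (pt (A u)) = pt (Y u)"
    and u: "u \<in> W" and g: "g_form B A u v v \<noteq> 0" "g_form B Y u v v \<noteq> 0"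
  shows "conformal_element B Y u v = conformal_element B A u v"
proof -
  have "coord_rep f A (W, Y) x = x" if "x \<in> W" for x
    using inv_into_f_f[OF local_liftsD(8)[OF Y] that] by (simp add: coord_rep_def fA[OF that])
  note * = has_derivative_transform_within_open[OF has_derivative_ident local_liftsD(1)[OF A] u this[symmetric]]
  have "D (coord_rep f A (W, Y)) u v = v" using fun_cong[OF D_eqI[OF *], of v] .
  moreover have "\<forall>v. let w = D (coord_rep f A (W, Y)) u v in
      g_form B A u v v \<noteq> 0 \<and> g_form B Y u w w \<noteq> 0 \<longrightarrow> conformal_element B Y u w = conformal_element B A u v"
    using elem A Y u fA[OF u] unfolding preserves_conformal_element_def by fast
  ultimately show ?thesis using g by (metis (no_types))
qed

text \<open>The sign \<open>s\<close> is \<open>- 1\<close> if the two hypersurfaces need opposite signs of the form.\<close>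

lemma normalized_pulled_back_lift:
  assumes x: "x \<in> V"
  obtains W A Y u0 s where "open W" "convex W" "u0 \<in> W" "x = pt (A u0)"
    "(W, A :: real^'k \<Rightarrow> real^'m) \<in> local_lifts V" "(W, Y :: real^'k \<Rightarrow> real^'m) \<in> local_lifts V'"
    "\<And>u. u \<in> W \<Longrightarrow> f (pt (A u)) = pt (Y u)" "s = 1 \<or> s = - 1"
    "\<And>u v w. u \<in> W \<Longrightarrow> B (D Y u v) (D Y u w) = s * B (D A u v) (D A u w)"
proof -
  obtain U A u0 where A: "(U, A :: real^'k \<Rightarrow> real^'m) \<in> local_lifts V" "u0 \<in> U" "x = pt (A u0)"
    using chart_at[OF x] .
  obtain W Z where W: "open W" "W \<subseteq> U" "u0 \<in> W" and Z: "(W, Z :: real^'k \<Rightarrow> real^'m) \<in> local_lifts V'"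
    and fZ: "\<And>u. u \<in> W \<Longrightarrow> f (pt (A u)) = pt (Z u)"
    by (rule pulled_back_lift[OF A(1,2)]) blast
  have AW: "(W, A) \<in> local_lifts V" using local_lifts_restrict[OF A(1) W(1,2)] .
  interpret A: null_lift B W A by (rule lift_null_lift[OF AW])
  interpret Z: null_lift B W Z by (rule lift_null_lift'[OF Z])
  have proportional: "\<exists>c. c \<noteq> 0 \<and> (\<forall>v w. B (D Z u v) (D Z u w) = c * B (D A u v) (D A u w))" if u: "u \<in> W" for u
  proof -
    obtain c e e' where "c > 0" "e = 1 \<or> e = - 1" "e' = 1 \<or> e' = - 1"
      "\<And>v w. B (D Z u v) (D Z u w) = c * e * e' * B (D A u v) (D A u w)"
      using corresponding_forms[OF A.null_lift_axioms Z.null_lift_axioms u not_umbilical[OF AW u]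
          element_of_pulled_back_lift[OF AW Z fZ u]] by metis
    then show ?thesis by (intro exI[of _ "c * e * e'"]) auto
  qed
  obtain a where a: "B (D A u0 a) (D A u0 a) \<noteq> 0"
    using nondegenerate_nonnull[OF A.metric_sym_form[OF W(3)] A.nd[OF W(3)]] .
  have a': "B (D Z u0 a) (D Z u0 a) \<noteq> 0" using proportional[OF W(3)] a by auto
  define sA where "sA = sgn (B (D A u0 a) (D A u0 a))"
  define sZ where "sZ = sgn (B (D Z u0 a) (D Z u0 a))"
  \<comment> \<open>\<open>proportional\<close> yields its factor only pointwise. Evaluating both
    metrics on one fixed direction \<open>a\<close> makes its absolute value the smooth quotient
    \<open>p / q\<close> near \<open>u0\<close>.\<close>
  define q where "q u = sA * B (D A u a) (D A u a)" for u
  define p where "p u = sZ * B (D Z u a) (D Z u a)" for u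
  have sgn: "sA = 1 \<or> sA = - 1" "sZ = 1 \<or> sZ = - 1" using a a' by (auto simp: sA_def sZ_def sgn_if)
  have smooth: "Ck_on k q W" "Ck_on k p W" for k
    unfolding q_def p_def
    by (intro Ck_on_bilinear[OF bounded_bilinear_mult] Ck_on_const
        Ck_on_bilinear[OF sym_form_bounded_bilinear[OF B(1)]] W(1)
        smooth_onD(3)[OF local_liftsD(2)[OF AW]] smooth_onD(3)[OF local_liftsD(2)[OF Z]])+
  have pos0: "q u0 > 0" "p u0 > 0" using a a' by (auto simp: q_def p_def sA_def sZ_def sgn_if)
  have "open (W \<inter> q -` {0<..})" "open (W \<inter> p -` {0<..})"
    using smooth[THEN Ck_on_continuous] W(1) by (auto intro!: continuous_open_preimage)
  then have "open ((W \<inter> q -` {0<..}) \<inter> (W \<inter> p -` {0<..}))" by (rule open_Int)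
  moreover have "u0 \<in> (W \<inter> q -` {0<..}) \<inter> (W \<inter> p -` {0<..})" using W(3) pos0 by simp
  ultimately obtain r where r: "r > 0" "ball u0 r \<subseteq> (W \<inter> q -` {0<..}) \<inter> (W \<inter> p -` {0<..})"
    by (rule openE)
  let ?K = "ball u0 r"
  have K: "?K \<subseteq> W" "\<And>u. u \<in> ?K \<Longrightarrow> q u > 0" "\<And>u. u \<in> ?K \<Longrightarrow> p u > 0" using r(2) by auto
  have AK: "(?K, A) \<in> local_lifts V" using local_lifts_restrict[OF AW _ K(1)] by simp
  have ZK: "(?K, Z) \<in> local_lifts V'" using local_lifts_restrict[OF Z _ K(1)] by simp
  \<comment> \<open>This is the square root of \<open>q / p\<close>, written so that
    \<open>Ck_on_inverse_sqrt\<close> applies.\<close>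
  define \<rho> where "\<rho> u = q u * (1 / sqrt (q u) * (1 / sqrt (p u)))" for u
  have smooth\<rho>: "smooth_on ?K \<rho>"
    unfolding smooth_on_def \<rho>_def
    by (intro allI Ck_on_bilinear[OF bounded_bilinear_mult] Ck_on_inverse_sqrt open_ball K
        Ck_on_subset[OF smooth(1) K(1)] Ck_on_subset[OF smooth(2) K(1)])
  have \<rho>2: "\<rho> u * \<rho> u = q u / p u" if "u \<in> ?K" for u
    using K(2,3)[OF that] by (simp add: \<rho>_def field_simps flip: real_sqrt_mult)
  have \<rho>0: "\<rho> u \<noteq> 0" if "u \<in> ?K" for u using K(2,3)[OF that] by (auto simp: \<rho>_def)
  let ?Y = "\<lambda>u. \<rho> u *\<^sub>R Z u"
  have Y: "(?K, ?Y) \<in> local_lifts V'"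
    and DY: "\<And>u v. u \<in> ?K \<Longrightarrow> D ?Y u v = \<rho> u *\<^sub>R D Z u v + D \<rho> u v *\<^sub>R Z u"
    using local_lifts_rescale[OF ZK smooth\<rho> \<rho>0] by blast+
  have fY: "f (pt (A u)) = pt (?Y u)" if "u \<in> ?K" for u
    using fZ[of u] pt_scaleR[OF local_liftsD(3)[OF ZK that] \<rho>0[OF that]] that K(1) by auto
  have "B (D ?Y u v) (D ?Y u w) = sA * sZ * B (D A u v) (D A u w)" if u: "u \<in> ?K" for u v w
  proof -
    have uW: "u \<in> W" using u K(1) by blast
    obtain c where c: "c \<noteq> 0" "\<And>v w. B (D Z u v) (D Z u w) = c * B (D A u v) (D A u w)"
      using proportional[OF uW] by blast
    have "B (D ?Y u v) (D ?Y u w) = \<rho> u * \<rho> u * B (D Z u v) (D Z u w)"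
      using Z.X_perp_D[OF uW] Z.null[OF uW] sym_form_commute[OF B(1), of "D Z u v" "Z u"]
      by (simp add: DY[OF u] Z.simps)
    also have "\<dots> = q u / p u * c * B (D A u v) (D A u w)" by (simp add: \<rho>2[OF u] c(2))
    also have "q u / p u * c = sA * sZ"
      using K(2,3)[OF u] c sgn by (auto simp: q_def p_def divide_simps)
    finally show ?thesis .
  qed
  moreover have "sA * sZ = 1 \<or> sA * sZ = - 1" using sgn by auto
  ultimately show ?thesis
    using that[of ?K u0 A ?Y "sA * sZ"] A(3) r(1) AK Y fY by simp
qed

section \<open>Gluing the local congruences\<close>

definition congruence_near :: "(real^'m \<Rightarrow> real^'m) \<Rightarrow> 'm projective \<Rightarrow> bool" where
  "congruence_near L x \<longleftrightarrow>
     (\<exists>S. openin (top_of_set V) S \<and> x \<in> S \<and> (\<forall>a. a \<noteq> 0 \<longrightarrow> pt a \<in> S \<longrightarrow> f (pt a) = pt (L a)))"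

lemma local_congruence:
  assumes x: "x \<in> V"
  obtains L where "similarity B L" "congruence_near L x"
proof -
  obtain W A Y u0 s where W: "open W" "convex W" "u0 \<in> W" "x = pt (A u0)"
    and AW: "(W, A :: real^'k \<Rightarrow> real^'m) \<in> local_lifts V" and Y: "(W, Y :: real^'k \<Rightarrow> real^'m) \<in> local_lifts V'"
    and fY: "\<And>u. u \<in> W \<Longrightarrow> f (pt (A u)) = pt (Y u)" and s: "s = 1 \<or> s = - 1"
    and metric: "\<And>u v w. u \<in> W \<Longrightarrow> B (D Y u v) (D Y u w) = s * B (D A u v) (D A u w)"
    by (rule normalized_pulled_back_lift[OF x]) blast
  interpret congruent_lifts B "\<lambda>x y. s * B x y" W A Y
    using congruent_lifts_of_element[OF lift_null_lift[OF AW] lift_null_lift'[OF Y] s metric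
        not_umbilical[OF AW] element_of_pulled_back_lift[OF AW Y fY]] .
  obtain L where L: "linear L" "\<And>a b. s * B (L a) (L b) = B a b" "\<And>u. u \<in> W \<Longrightarrow> Y u = L (A u)"
    using congruence[OF W(2,3)] by metis
  have "similarity B L" using L s unfolding similarity_def by blast
  moreover have "f (pt a) = pt (L a)" if a: "a \<noteq> 0" "pt a \<in> chart A ` W" for a
  proof -
    obtain u where u: "u \<in> W" "pt a = pt (A u)" using a(2) by blast
    obtain c where c: "c \<noteq> 0" "a = c *\<^sub>R A u"
      using u(2) a(1) local_liftsD(3)[OF AW u(1)] pt_eq_iff by metis
    have "L a = c *\<^sub>R Y u" using c(2) L(1,3) u(1) by (simp add: linear_scale)
    then have "pt (L a) = pt (Y u)" using pt_scaleR[OF local_liftsD(3)[OF Y u(1)] c(1)] by simp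
    then show ?thesis using fY[OF u(1)] u(2) by simp
  qed
  then have "congruence_near L x"
    unfolding congruence_near_def using local_liftsD(5)[OF AW] W(3,4) by blast
  ultimately show ?thesis by (rule that)
qed

text \<open>The inverse of \<open>L2\<close> composed with \<open>L1\<close> fixes every point of a
  piece of \<open>V\<close>, so it multiplies each vector of the lift by a number; nonumbilicity
  then makes it a scalar map.\<close>

lemma congruence_near_unique:
  assumes x: "x \<in> V" and L: "similarity B L1" "similarity B L2"
    and near: "congruence_near L1 x" "congruence_near L2 x"
  obtains c where "c \<noteq> 0" "\<And>a. L1 a = c *\<^sub>R L2 a"
proof -
  obtain U A u0 where A: "(U, A :: real^'k \<Rightarrow> real^'m) \<in> local_lifts V" "u0 \<in> U" "x = pt (A u0)"
    using chart_at[OF x] .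
  note LL = local_liftsD[OF A(1)]
  obtain S1 where S1: "openin (top_of_set V) S1" "x \<in> S1"
    "\<And>a. a \<noteq> 0 \<Longrightarrow> pt a \<in> S1 \<Longrightarrow> f (pt a) = pt (L1 a)" using near(1) unfolding congruence_near_def by blast
  obtain S2 where S2: "openin (top_of_set V) S2" "x \<in> S2"
    "\<And>a. a \<noteq> 0 \<Longrightarrow> pt a \<in> S2 \<Longrightarrow> f (pt a) = pt (L2 a)" using near(2) unfolding congruence_near_def by blast
  obtain T where T: "open T" "S1 \<inter> S2 = V \<inter> T"
    using openin_Int[OF S1(1) S2(1)] by (auto simp: openin_open)
  define W where "W = U \<inter> chart A -` T"
  have W: "open W" "W \<subseteq> U" using continuous_open_preimage[OF LL(7,1) T(1)] by (auto simp: W_def)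
  have u0: "u0 \<in> W" using A S1(2) S2(2) T(2) by (auto simp: W_def)
  have WS: "pt (A u) \<in> S1 \<inter> S2" if "u \<in> W" for u using that LL(9) T(2) by (auto simp: W_def)
  interpret null_lift B W A
    using null_lift.restrict[OF lift_null_lift[OF A(1)] W] .
  obtain s1 where s1: "linear L1" "s1 = 1 \<or> s1 = - 1" "\<And>a b. s1 * B (L1 a) (L1 b) = B a b"
    using L(1) by (auto simp: similarity_def)
  obtain s2 where s2: "linear L2" "s2 = 1 \<or> s2 = - 1" "\<And>a b. s2 * B (L2 a) (L2 b) = B a b"
    using L(2) by (auto simp: similarity_def)
  have bij: "bij L1" "bij L2" using similarity_bij[OF B] L by blast+
  obtain M where M: "linear M" "M \<circ> L2 = id"
    using linear_injective_left_inverse[OF s2(1)] bij(2) by (auto simp: bij_def)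
  have LM: "L2 (M b) = b" "M (L2 b) = b" for b
  proof -
    have left: "M (L2 b) = b" for b using fun_cong[OF M(2), of b] by simp
    then show "M (L2 b) = b" .
    obtain a where "b = L2 a" using bij(2) by (metis bij_pointE)
    then show "L2 (M b) = b" by (simp add: left)
  qed
  have "linear (\<lambda>a. M (L1 a))" using linear_compose[OF s1(1) M(1)] by (simp add: o_def)
  moreover have "B (M (L1 a)) (M (L1 b)) = (s1 * s2) * B a b" for a b
    using s2(3)[of "M (L1 a)" "M (L1 b)"] s1(3)[of a b] s1(2) s2(2) by (auto simp: LM)
  moreover have "s1 * s2 \<noteq> 0" using s1(2) s2(2) by auto
  moreover have "\<exists>c. M (L1 (A u)) = c *\<^sub>R A u" if u: "u \<in> W" for u
  proof -
    have "pt (L1 (A u)) = pt (L2 (A u))"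
      using S1(3)[OF nonzero[OF u]] S2(3)[OF nonzero[OF u]] WS[OF u] by simp
    moreover have "L1 (A u) \<noteq> 0" "L2 (A u) \<noteq> 0"
      using nonzero[OF u] bij linear_injective_0[OF s1(1)] linear_injective_0[OF s2(1)]
      unfolding bij_def by blast+
    ultimately obtain c where "L1 (A u) = c *\<^sub>R L2 (A u)" using pt_eq_iff by metis
    then have "M (L1 (A u)) = c *\<^sub>R A u" by (simp add: linear_scale[OF M(1)] LM)
    then show ?thesis ..
  qed
  moreover have "\<exists>N e. tangent_frame B (A u0) (D A u0) N e \<and> nonumbilic u0 N"
  proof -
    obtain e where e: "e = 1 \<or> e = - 1" and ae: "adapted_form B A u0 = (\<lambda>x y. e * B x y)"
      and tA: "tangent_frame B (A u0) (D A u0) (normal_vector B A u0) e"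
      using adapted_normal[OF null_lift_axioms u0] .
    have "nonumbilic u0 (normal_vector B A u0)"
      unfolding nonumbilic_def
    proof
      assume "\<exists>\<kappa>. \<forall>v w. B (D2 A u0 v w) (normal_vector B A u0) = \<kappa> * B (D A u0 v) (D A u0 w)"
      then obtain k where "\<And>v w. B (D2 A u0 v w) (normal_vector B A u0) = k * B (D A u0 v) (D A u0 w)"
        by blast
      then have "\<forall>v w. h_tilde B A u0 v w = k * g_form B A u0 v w"
        by (simp add: h_tilde_def g_form_def first_form_def ae)
      then show False using not_umbilical[OF A(1,2)] by blast
    qed
    with tA show ?thesis by blast
  qed
  ultimately obtain c where c: "\<And>a. M (L1 a) = c *\<^sub>R a"
    using similarity_fixing_lift_is_scalar[of "\<lambda>a. M (L1 a)" "s1 * s2" u0] u0 by metis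
  have "L1 a = c *\<^sub>R L2 a" for a
    using arg_cong[OF c[of a], of L2] by (simp add: LM linear_scale[OF s2(1)])
  moreover have "c \<noteq> 0"
  proof
    assume "c = 0"
    then have "L1 (A u0) = 0" using calculation by simp
    then show False
      using nonzero[OF u0] bij(1) linear_injective_0[OF s1(1)] unfolding bij_def by blast
  qed
  ultimately show ?thesis using that by blast
qed

lemma congruence_near_openD:
  assumes "congruence_near L x"
  obtains S where "openin (top_of_set V) S" "x \<in> S" "\<And>y. y \<in> S \<Longrightarrow> congruence_near L y"
  using assms unfolding congruence_near_def by metis

lemma congruence_near_scale:
  assumes near: "congruence_near L1 x" and L2: "similarity B L2"
    and c: "c \<noteq> 0" "\<And>a. L1 a = c *\<^sub>R L2 a"
  shows "congruence_near L2 x"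
proof -
  have "pt (L1 a) = pt (L2 a)" if "a \<noteq> 0" for a
  proof -
    have "linear L2" using L2 by (simp add: similarity_def)
    then have "L2 a \<noteq> 0"
      using that similarity_bij[OF B L2] linear_injective_0 unfolding bij_def by blast
    then show ?thesis using pt_scaleR c by metis
  qed
  then show ?thesis using near unfolding congruence_near_def by metis
qed

text \<open>The set where one fixed \<open>L\<close> induces \<open>f\<close> locally is open by
  definition. So is its complement: near a point outside, another \<open>L1\<close> induces
  \<open>f\<close>, and a common point would make \<open>L1\<close> proportional to
  \<open>L\<close>, putting the outside point into the set.\<close>

theorem conformally_equivalent:
  assumes conn: "connected V"
  shows "\<exists>\<phi>. conformal_transformation B \<phi> \<and> \<phi> ` V = V'"
proof (cases "V = {}")
  case True
  \<comment> \<open>The empty set counts as connected; then \<open>V'\<close> is empty as well and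
    any conformal transformation will do.\<close>
  have "similarity B (\<lambda>a. a)" unfolding similarity_def by (auto intro!: exI[of _ 1] linearI)
  from similarity_conformal[OF B this] obtain \<phi> where "conformal_transformation B \<phi>" by metis
  moreover have "V' = {}" using True f_bij by (auto simp: bij_betw_def)
  ultimately show ?thesis using True by auto
next
  case False
  then obtain x0 where x0: "x0 \<in> V" by blast
  obtain L where L: "similarity B L" "congruence_near L x0" using local_congruence[OF x0] .
  define S where "S = {x\<in>V. congruence_near L x}"
  have "openin (top_of_set V) S"
    unfolding openin_subopen[of _ S]
  proof
    fix x assume x: "x \<in> S"
    then obtain T where T: "openin (top_of_set V) T" "x \<in> T" "\<And>y. y \<in> T \<Longrightarrow> congruence_near L y"
      using congruence_near_openD unfolding S_def by blast
    then have "T \<subseteq> S" using openin_imp_subset[OF T(1)] by (auto simp: S_def)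
    then show "\<exists>T. openin (top_of_set V) T \<and> x \<in> T \<and> T \<subseteq> S" using T by blast
  qed
  moreover have "openin (top_of_set V) (V - S)"
    unfolding openin_subopen[of _ "V - S"]
  proof
    fix x assume x: "x \<in> V - S"
    obtain L1 where L1: "similarity B L1" "congruence_near L1 x" using local_congruence[of x] x by blast
    obtain T where T: "openin (top_of_set V) T" "x \<in> T" "\<And>y. y \<in> T \<Longrightarrow> congruence_near L1 y"
      using congruence_near_openD[OF L1(2)] by blast
    have "y \<notin> S" if y: "y \<in> T" for y
    proof
      assume "y \<in> S"
      then have "y \<in> V" "congruence_near L y" by (auto simp: S_def)
      then obtain c where "c \<noteq> 0" "\<And>a. L1 a = c *\<^sub>R L a"
        using congruence_near_unique[OF _ L1(1) L(1) T(3)[OF y]] by blast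
      then have "congruence_near L x" using congruence_near_scale[OF L1(2) L(1)] by blast
      then show False using x by (simp add: S_def)
    qed
    then have "T \<subseteq> V - S" using openin_imp_subset[OF T(1)] by blast
    then show "\<exists>T. openin (top_of_set V) T \<and> x \<in> T \<and> T \<subseteq> V - S" using T by blast
  qed
  moreover have "S \<subseteq> V" by (auto simp: S_def)
  ultimately have "S = V"
    using conn x0 L(2) unfolding connected_clopen closedin_def S_def by auto
  obtain \<phi> where \<phi>: "conformal_transformation B \<phi>" "\<And>X. X \<noteq> 0 \<Longrightarrow> \<phi> (pt X) = pt (L X)"
    using similarity_conformal[OF B L(1)] by blast
  have "\<phi> x = f x" if "x \<in> V" for x
  proof -
    obtain a where a: "a \<noteq> 0" "x = pt a" by (rule pt_surj)
    have "congruence_near L x" using that \<open>S = V\<close> by (auto simp: S_def)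
    then have "f x = pt (L a)" using a unfolding congruence_near_def by metis
    then show ?thesis using \<phi>(2)[OF a(1)] a(2) by simp
  qed
  then have "\<phi> ` V = V'" using f_bij by (simp add: bij_betw_def)
  then show ?thesis using \<phi>(1) by blast
qed

end

theorem mainTheorem1:
  fixes n p q :: nat
    and B :: "'m::finite form"
    and V V' :: "'m projective set"
    and Or Or' :: "('k::finite, 'm) lift set"
    and f :: "'m projective \<Rightarrow> 'm projective"
  assumes "n \<ge> 4" and "p + q = n"
    and "CARD('m) = n + 2" and "CARD('k) = n - 1"
    and "symmetric_form_of_signature B (p + 1) (q + 1)"
    and "oriented_hypersurface B V Or" and "connected V" and "simply_connected V"
    and "oriented_hypersurface B V' Or'" and "connected V'" and "simply_connected V'"
    and "nonisotropic TYPE('k) B V" and "nonisotropic TYPE('k) B V'"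
    and "\<forall>x\<in>V. \<not> umbilical_point TYPE('k) B V x"
    and "\<forall>x\<in>V'. \<not> umbilical_point TYPE('k) B V' x"
    and "smooth_correspondence TYPE('k) V V' f"
    and "preserves_conformal_element TYPE('k) B V V' f"
  shows "\<exists>\<phi>. conformal_transformation B \<phi> \<and> \<phi> ` V = V'"
proof -
  \<comment> \<open>Here \<open>n \<ge> 4\<close> becomes the bound 3 on the dimension of the
    tangent spaces, and n + 2 = (n - 1) + 3.\<close>
  have "CARD('m) = CARD('k) + 3" "CARD('k) \<ge> 3" using assms(1,3,4) by auto
  then interpret hypersurface_correspondence B V V' Or Or' f
    using signature_sym_form[OF assms(5)] assms by unfold_locales
  show ?thesis using assms(7) by (rule conformally_equivalent)
qed

end
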